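(* Let ${\bf x}_1,\dots,{\bf x}_n\in\mathbb{R}^2$ be a given sequence of $n$ distinct points, any two of which are at distance at least $4$, let the minimum turning radius be $\rho=1$, and let $L:(S^1)^n\to\mathbb{R}^+$ be the map assigning to $\boldsymbol\theta=(\theta_1,\dots,\theta_n)$ the length of the corresponding curvature-constrained tour through ${\bf x}_1,\dots,{\bf x}_n$ (in this order). Then, for each $i=1,\dots,n$, the $i$th partial derivative of the length of the tour may be expressed as $$\frac{\partial L}{\partial\theta_i}=-\tau_i,$$ where $$\tau_i=\left({\bf r}_{i2}\times\hat{\bf u}_i-{\bf r}_{i1}\times\hat{\bf u}_{i-1}\right)\cdot\hat{\bf z}$$ (the index $i-1$ being read cyclically, so $\hat{\bf u}_0=\hat{\bf u}_n$) may be interpreted as the signed magnitude of the total torque exerted upon the $i$th pair of disks by the elastic band representing the tour.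
   Context: A directed point is a pair $({\bf x},\theta)\in\mathbb{R}^2\times S^1$, with associated unit tangent vector $(\cos\theta,\sin\theta)$ at ${\bf x}$. A Dubins curve between two directed points is a shortest curve whose curvature is at most $\rho^{-1}=1$, starting and ending at the given points with the given tangent directions. A Dubins curve is of type $CSC$ if it consists of an arc of a unit-radius circle, followed by a straight segment, followed by an arc of a unit-radius circle. Since the points are at distance at least $4$ from one another (the "long path case"), the Dubins curves are taken to be of type $CSC$. Given $\boldsymbol\theta=(\theta_1,\dots,\theta_n)$, the corresponding tour is the closed curve obtained by concatenating, for $i=1,\dots,n$ (indices cyclic mod $n$), the Dubins curve from $({\bf x}_i,\theta_i)$ to $({\bf x}_{i+1},\theta_{i+1})$; $L(\boldsymbol\theta)$ is its total length. For each $i$, the $i$th straight segment is the straight segment of the Dubins curve from $({\bf x}_i,\theta_i)$ to $({\bf x}_{i+1},\theta_{i+1})$. Its initial point is denoted ${\bf t}_{i2}$ and its final point ${\bf t}_{(i+1)1}$ (first index cyclic mod $n$). $\hat{\bf u}_i$ is the unit vector which points along the $i$th straight segment and has the same orientation as the tour. Put ${\bf r}_{i1}={\bf t}_{i1}-{\bf x}_i$ and ${\bf r}_{i2}={\bf t}_{i2}-{\bf x}_i$. The plane is viewed as the horizontal plane in $\mathbb{R}^3$, $\times$ is the cross product, and $\hat{\bf z}$ is the upward unit normal, so $({\bf a}\times{\bf b})\cdot\hat{\bf z}=a_1b_2-a_2b_1$. Mechanical model: the tour is represented by an elastic band which, at each ${\bf x}_i$, runs between a pair of unit-radius disks touching at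 ${\bf x}_i$ and having $(\cos\theta_i,\sin\theta_i)$ as common tangent direction there; each pair of disks is free to rotate in the plane about ${\bf x}_i$.
   Formalization: L can have a kink where a Dubins curve at x_i is not unique, so the partial derivative is shown to exist (and equal −τ_i) only when the Dubins curves arriving at and leaving x_i are unique; wherever it exists, it is shown to equal −τ_i. The number of points n is at least 2. *)

theory Defs
  imports "HOL-Analysis.Analysis"
begin

text \<open>Directed points are pairs of a position and an angle; angles are real numbers (lifted from
  the circle), and enter only through the unit vector below, hence only modulo a full turn.\<close>

definition heading :: "real \<Rightarrow> real^2" where
  "heading \<phi> = vector [cos \<phi>, sin \<phi>]"

text \<open>Curves are parametrised by arc length on \<open>{0..l}\<close>. A curvature bound of 1 means that the unit
  tangent \<open>v\<close> exists and is 1-Lipschitz (Dubins' average curvature condition); curvature in the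
  pointwise sense need not exist where the pieces of a curve meet.\<close>

definition curvature_bounded_curve ::
    "real^2 \<Rightarrow> real \<Rightarrow> real^2 \<Rightarrow> real \<Rightarrow> real \<Rightarrow> (real \<Rightarrow> real^2) \<Rightarrow> bool" where
  "curvature_bounded_curve p \<alpha> q \<beta> l \<gamma> \<longleftrightarrow> 0 \<le> l \<and>
     (\<exists>v. (\<forall>s\<in>{0..l}. (\<gamma> has_vector_derivative v s) (at s within {0..l}) \<and> norm (v s) = 1) \<and>
          1-lipschitz_on {0..l} v \<and>
          \<gamma> 0 = p \<and> v 0 = heading \<alpha> \<and> \<gamma> l = q \<and> v l = heading \<beta>)"

definition dubins_curve ::
    "real^2 \<Rightarrow> real \<Rightarrow> real^2 \<Rightarrow> real \<Rightarrow> real \<Rightarrow> (real \<Rightarrow> real^2) \<Rightarrow> bool" where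
  "dubins_curve p \<alpha> q \<beta> l \<gamma> \<longleftrightarrow> curvature_bounded_curve p \<alpha> q \<beta> l \<gamma> \<and>
     (\<forall>l' \<gamma>'. curvature_bounded_curve p \<alpha> q \<beta> l' \<gamma>' \<longrightarrow> l \<le> l')"

text \<open>Here \<open>\<sigma>\<close> is the direction of travel (1 for a left turn, -1 for a right turn).\<close>

definition unit_circle_arc :: "(real \<Rightarrow> real^2) \<Rightarrow> real \<Rightarrow> real \<Rightarrow> bool" where
  "unit_circle_arc \<gamma> a b \<longleftrightarrow>
     (\<exists>c \<phi> \<sigma>. \<sigma> \<in> {-1, 1} \<and> (\<forall>s\<in>{a..b}. \<gamma> s = c + heading (\<phi> + \<sigma> * (s - a))))"

text \<open>A leg of a tour: a curve \<open>leg_pos\<close> of length \<open>leg_len\<close> together with the parameters at which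
  its straight segment begins and ends and the direction of that segment.\<close>

record leg =
  leg_len :: real
  leg_pos :: "real \<Rightarrow> real^2"
  seg_begin :: real
  seg_end :: real
  seg_dir :: "real^2"

text \<open>Type CSC. The three pieces may have length zero. The condition that \<open>seg_dir\<close> is the tangent
  vector at the beginning of the segment follows from the preceding one if the segment has
  positive length; it determines \<open>seg_dir\<close> also for a segment of length zero.\<close>

definition csc_type :: "leg \<Rightarrow> bool" where
  "csc_type c \<longleftrightarrow>
     0 \<le> seg_begin c \<and> seg_begin c \<le> seg_end c \<and> seg_end c \<le> leg_len c \<and>
     unit_circle_arc (leg_pos c) 0 (seg_begin c) \<and>
     (\<forall>s\<in>{seg_begin c..seg_end c}.
        leg_pos c s = leg_pos c (seg_begin c) + (s - seg_begin c) *\<^sub>R seg_dir c) \<and>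
     (leg_pos c has_vector_derivative seg_dir c) (at (seg_begin c) within {0..leg_len c}) \<and>
     unit_circle_arc (leg_pos c) (seg_end c) (leg_len c)"

text \<open>Cyclic successor and predecessor on \<open>{1..n}\<close>.\<close>

definition cnext :: "nat \<Rightarrow> nat \<Rightarrow> nat" where
  "cnext n i = (if i = n then 1 else i + 1)"

definition cprev :: "nat \<Rightarrow> nat \<Rightarrow> nat" where
  "cprev n i = (if i = 1 then n else i - 1)"

text \<open>\<open>T i\<close> is the leg from the \<open>i\<close>th directed point to the next one.\<close>

definition dubins_tour ::
    "nat \<Rightarrow> (nat \<Rightarrow> real^2) \<Rightarrow> (nat \<Rightarrow> real) \<Rightarrow> (nat \<Rightarrow> leg) \<Rightarrow> bool" where
  "dubins_tour n x \<theta> T \<longleftrightarrow>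
     (\<forall>i\<in>{1..n}.
        dubins_curve (x i) (\<theta> i) (x (cnext n i)) (\<theta> (cnext n i)) (leg_len (T i)) (leg_pos (T i)) \<and>
        csc_type (T i))"

definition tour_length :: "nat \<Rightarrow> (nat \<Rightarrow> leg) \<Rightarrow> real" where
  "tour_length n T = (\<Sum>i=1..n. leg_len (T i))"

text \<open>The \<open>i\<close>th Dubins curve of the tour is the only one. Comparing the parametrisations on
  \<open>{0..l}\<close> suffices, since all Dubins curves between two directed points have the same length.\<close>

definition unique_dubins_leg ::
    "nat \<Rightarrow> (nat \<Rightarrow> real^2) \<Rightarrow> (nat \<Rightarrow> real) \<Rightarrow> (nat \<Rightarrow> leg) \<Rightarrow> nat \<Rightarrow> bool" where
  "unique_dubins_leg n x \<theta> T i \<longleftrightarrow>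
     (\<forall>l \<gamma>. dubins_curve (x i) (\<theta> i) (x (cnext n i)) (\<theta> (cnext n i)) l \<gamma> \<longrightarrow>
        (\<forall>s\<in>{0..l}. \<gamma> s = leg_pos (T i) s))"

text \<open>\<open>tpt1 n T i\<close> is the final point of the segment arriving at the \<open>i\<close>th point, \<open>tpt2 T i\<close> the
  initial point of the segment departing from it.\<close>

definition tpt1 :: "nat \<Rightarrow> (nat \<Rightarrow> leg) \<Rightarrow> nat \<Rightarrow> real^2" where
  "tpt1 n T i = leg_pos (T (cprev n i)) (seg_end (T (cprev n i)))"

definition tpt2 :: "(nat \<Rightarrow> leg) \<Rightarrow> nat \<Rightarrow> real^2" where
  "tpt2 T i = leg_pos (T i) (seg_begin (T i))"

definition horiz :: "real^2 \<Rightarrow> real^3" where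
  "horiz a = vector [a $ 1, a $ 2, 0]"

definition zhat :: "real^3" where
  "zhat = axis 3 1"

lemma cross3_horiz_zhat: "cross3 (horiz a) (horiz b) \<bullet> zhat = a $ 1 * b $ 2 - a $ 2 * b $ 1"
  by (simp add: horiz_def zhat_def cross3_def inner_axis)

definition tau :: "nat \<Rightarrow> (nat \<Rightarrow> real^2) \<Rightarrow> (nat \<Rightarrow> leg) \<Rightarrow> nat \<Rightarrow> real" where
  "tau n x T i =
     (let r1 = tpt1 n T i - x i;
          r2 = tpt2 T i - x i
      in (cross3 (horiz r2) (horiz (seg_dir (T i))) -
          cross3 (horiz r1) (horiz (seg_dir (T (cprev n i))))) \<bullet> zhat)"

definition torque :: "real^2 \<Rightarrow> real^2 \<Rightarrow> real^2 \<Rightarrow> real^3" where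
  "torque pivot p force = cross3 (horiz (p - pivot)) (horiz force)"

text \<open>The mechanical model: the band has unit tension, so the part of it that runs between the two
  disks at the \<open>i\<close>th point is pulled along the departing segment at \<open>tpt2 T i\<close> and backwards along
  the arriving segment at \<open>tpt1 n T i\<close>, and transmits these two forces to the pair of disks.\<close>

definition band_torque :: "nat \<Rightarrow> (nat \<Rightarrow> real^2) \<Rightarrow> (nat \<Rightarrow> leg) \<Rightarrow> nat \<Rightarrow> real^3" where
  "band_torque n x T i =
     torque (x i) (tpt2 T i) (seg_dir (T i)) +
     torque (x i) (tpt1 n T i) (- seg_dir (T (cprev n i)))"

end

theory Submission
  imports Defs
begin

text \<open>Fix one leg, with displacement \<open>v\<close> between its end points, and describe a path of type CSC by the
  direction \<open>\<psi>\<close> of its segment. If it turns by the signed angles \<open>\<psi> - \<alpha>\<close> and \<open>\<beta> - \<psi>\<close>, its length is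
  \<open>W \<psi> = h (\<psi> - \<alpha>) + h (\<psi> - \<beta>) + v \<bullet> heading \<psi>\<close> with \<open>h x = \<bar>x\<bar> - sin \<bar>x\<bar>\<close>. The two arcs and the segment
  fit together exactly when \<open>W' \<psi> = 0\<close>, and the segment has length \<open>- W'' \<psi>\<close>. As \<open>h\<close> is twice
  differentiable even at 0, arcs of length zero need no special treatment. By the envelope
  principle, the derivative of the length with respect to \<open>\<alpha>\<close> is the partial derivative
  \<open>- h' (\<psi> - \<alpha>)\<close>, which is minus the moment about the end point of the unit force along the segment.
  This also holds if the segment has length zero: distance at least 4 then makes \<open>W'\<close> a multiple of
  \<open>1 - cos\<close> near \<open>\<psi>\<close>.

  Perturbing the critical point bounds the length of the Dubins curve from above, to first order in
  the angle, so any derivative that exists has the stated value. If the Dubins curve is unique,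
  then compactness of the set of CSC parameters gives the matching bound from below.\<close>

section \<open>The length as a function of the segment direction\<close>

text \<open>Away from 0 the sign is locally constant. At 0 the quotient
  \<open>sgn h * f h / h\<close> is dominated by \<open>f h / h\<close>, which tends to
  \<open>f' 0 = 0\<close>, so the jump of the sign leaves no kink.\<close>

lemma has_real_derivative_sgn_mult:
  fixes f f' :: "real \<Rightarrow> real"
  assumes "\<And>x. (f has_real_derivative f' x) (at x)" and "f 0 = 0" "f' 0 = 0"
  shows "((\<lambda>x. sgn x * f x) has_real_derivative sgn x * f' x) (at x)"
proof (cases "x = 0")
  case True
  have "((\<lambda>h. f h / h) \<longlongrightarrow> 0) (at 0)"
    using assms(1)[of 0] assms(2,3) by (simp add: DERIV_def)
  moreover have "eventually (\<lambda>h. norm (sgn h * f h / h) \<le> norm (f h / h)) (at 0)"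
    by (auto simp: eventually_at_filter abs_mult abs_sgn_eq)
  ultimately have "((\<lambda>h. sgn h * f h / h) \<longlongrightarrow> 0) (at 0)"
    by (rule Lim_null_comparison[OF _ tendsto_norm_zero, rotated])
  then show ?thesis using True assms by (simp add: DERIV_def)
next
  case False
  have "((\<lambda>y. sgn x * f y) has_real_derivative sgn x * f' x) (at x)"
    using assms(1) by (rule DERIV_cmult)
  then show ?thesis
  proof (rule has_field_derivative_transform_within_open)
    show "open (if x > 0 then {0<..} else {..<0} :: real set)" by simp
    show "x \<in> (if x > 0 then {0<..} else {..<0} :: real set)" using False by auto
  qed (use False in \<open>auto split: if_splits\<close>)
qed

text \<open>An arc turning by \<open>x\<close> into or out of the segment advances by
  \<open>sin \<bar>x\<bar>\<close> along the segment's direction; the cost is the excess of its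
  length over that advance.\<close>

definition turn_cost :: "real \<Rightarrow> real" where
  "turn_cost x = \<bar>x\<bar> - sin \<bar>x\<bar>"

text \<open>The signed offset of such an arc across the segment: the lever arm, about the outer end
  of the arc, of a unit force along the segment. It is the derivative of
  \<open>turn_cost\<close>.\<close>

definition turn_lever :: "real \<Rightarrow> real" where
  "turn_lever x = sgn x * (1 - cos x)"

lemma turn_lever_minus [simp]: "turn_lever (- x) = - turn_lever x"
  by (simp add: turn_lever_def sgn_minus)

lemma turn_lever_deriv [derivative_intros]:
  assumes "(g has_real_derivative g') (at x within S)"
  shows "((\<lambda>x. turn_lever (g x)) has_real_derivative sin \<bar>g x\<bar> * g') (at x within S)"
proof -
  have "(turn_lever has_real_derivative sgn y * sin y) (at y)" for y
    unfolding turn_lever_def[abs_def]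
    by (rule has_real_derivative_sgn_mult) (auto intro!: derivative_eq_intros)
  moreover have "sgn y * sin y = sin \<bar>y\<bar>" for y :: real
    by (auto simp: sgn_if abs_if)
  ultimately show ?thesis using DERIV_chain2[OF _ assms] by metis
qed

lemma turn_cost_deriv [derivative_intros]:
  assumes "(g has_real_derivative g') (at x within S)"
  shows "((\<lambda>x. turn_cost (g x)) has_real_derivative turn_lever (g x) * g') (at x within S)"
proof -
  have "((\<lambda>x. sgn x * (x - sin x)) has_real_derivative sgn y * (1 - cos y)) (at y)" for y :: real
    by (rule has_real_derivative_sgn_mult) (auto intro!: derivative_eq_intros)
  moreover have "(\<lambda>x. sgn x * (x - sin x)) = turn_cost"
    by (auto simp: turn_cost_def sgn_if abs_if)
  ultimately show ?thesis using DERIV_chain2[OF _ assms] unfolding turn_lever_def by metis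
qed

lemma tendsto_turn_lever [tendsto_intros]:
  assumes "(f \<longlongrightarrow> a) F"
  shows "((\<lambda>x. turn_lever (f x)) \<longlongrightarrow> turn_lever a) F"
  using DERIV_isCont[OF turn_lever_deriv[OF DERIV_ident]] assms by (rule isCont_tendsto_compose)

lemma tendsto_turn_cost [tendsto_intros]:
  assumes "(f \<longlongrightarrow> a) F"
  shows "((\<lambda>x. turn_cost (f x)) \<longlongrightarrow> turn_cost a) F"
  using DERIV_isCont[OF turn_cost_deriv[OF DERIV_ident]] assms by (rule isCont_tendsto_compose)

lemma turn_lever_lipschitz: "\<bar>turn_lever x - turn_lever y\<bar> \<le> \<bar>x - y\<bar>"
proof -
  have "norm (turn_lever x - turn_lever y) \<le> 1 * norm (x - y)"
  proof (rule field_differentiable_bound[of UNIV])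
    show "(turn_lever has_field_derivative sin \<bar>z\<bar>) (at z within UNIV)" for z
      using turn_lever_deriv[OF DERIV_ident] by simp
  qed auto
  then show ?thesis by simp
qed

text \<open>The last three arguments are the initial heading, the final heading and the direction of the
  segment; a full turn added to a heading adds a full turn to an arc. The slope and minus the segment
  length are the first and second derivative of the length.\<close>

definition csc_length :: "real^2 \<Rightarrow> real \<Rightarrow> real \<Rightarrow> real \<Rightarrow> real" where
  "csc_length v \<alpha> \<beta> \<psi> = turn_cost (\<psi> - \<alpha>) + turn_cost (\<psi> - \<beta>) + (v $ 1 * cos \<psi> + v $ 2 * sin \<psi>)"

definition csc_slope :: "real^2 \<Rightarrow> real \<Rightarrow> real \<Rightarrow> real \<Rightarrow> real" where
  "csc_slope v \<alpha> \<beta> \<psi> = turn_lever (\<psi> - \<alpha>) + turn_lever (\<psi> - \<beta>) - (v $ 1 * sin \<psi> - v $ 2 * cos \<psi>)"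

definition csc_segment :: "real^2 \<Rightarrow> real \<Rightarrow> real \<Rightarrow> real \<Rightarrow> real" where
  "csc_segment v \<alpha> \<beta> \<psi> = v $ 1 * cos \<psi> + v $ 2 * sin \<psi> - sin \<bar>\<psi> - \<alpha>\<bar> - sin \<bar>\<psi> - \<beta>\<bar>"

text \<open>The inequality excludes critical points at which the curve would close only with its
  segment run backwards.\<close>

definition csc_param :: "real^2 \<Rightarrow> real \<Rightarrow> real \<Rightarrow> real \<Rightarrow> bool" where
  "csc_param v \<alpha> \<beta> \<psi> \<longleftrightarrow> csc_slope v \<alpha> \<beta> \<psi> = 0 \<and> 0 \<le> csc_segment v \<alpha> \<beta> \<psi>"

lemma csc_length_alt:
  "csc_length v \<alpha> \<beta> \<psi> = \<bar>\<psi> - \<alpha>\<bar> + csc_segment v \<alpha> \<beta> \<psi> + \<bar>\<beta> - \<psi>\<bar>"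
  by (simp add: csc_length_def csc_segment_def turn_cost_def)

lemma csc_length_deriv:
  "((csc_length v \<alpha> \<beta>) has_real_derivative csc_slope v \<alpha> \<beta> \<psi>) (at \<psi>)"
  unfolding csc_length_def[abs_def] csc_slope_def
  by (auto intro!: derivative_eq_intros)

lemma csc_slope_deriv:
  "((csc_slope v \<alpha> \<beta>) has_real_derivative - csc_segment v \<alpha> \<beta> \<psi>) (at \<psi>)"
  unfolding csc_slope_def[abs_def] csc_segment_def
  by (auto intro!: derivative_eq_intros)

lemma csc_slope_lipschitz:
  "\<bar>csc_slope v t \<beta> \<psi> - csc_slope v t' \<beta> \<psi>\<bar> \<le> \<bar>t - t'\<bar>"
  using turn_lever_lipschitz[of "\<psi> - t" "\<psi> - t'"] by (simp add: csc_slope_def)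

lemma csc_segment_pos_nearby:
  assumes "csc_segment v \<alpha> \<beta> \<psi> > 0"
  shows "\<exists>r>0. \<forall>z. \<bar>z - \<psi>\<bar> < r \<longrightarrow> csc_segment v \<alpha> \<beta> z > 0"
proof -
  have "isCont (csc_segment v \<alpha> \<beta>) \<psi>"
    unfolding csc_segment_def[abs_def] by (intro continuous_intros)
  then have "eventually (\<lambda>z. csc_segment v \<alpha> \<beta> z > 0) (nhds \<psi>)"
    using assms by (simp add: isCont_def order_tendstoD(1) continuous_within tendsto_at_iff_tendsto_nhds)
  then show ?thesis
    by (auto simp: eventually_nhds_metric dist_real_def)
qed

section \<open>Critical points with a segment of length zero\<close>

lemma cos_eq_minus_one_imp: "cos x = - 1 \<Longrightarrow> pi \<le> \<bar>x\<bar>" for x :: real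
  using cos_monotone_0_pi[of "\<bar>x\<bar>" pi] by fastforce

lemma sum_squares_rotation:
  "(a * c + b * s)\<^sup>2 + (a * s - b * c)\<^sup>2 = (a\<^sup>2 + b\<^sup>2) * (c\<^sup>2 + s\<^sup>2)" for a b c s :: real
  by (simp add: power2_eq_square algebra_simps)

lemma parallelogram_law_2:
  "(a + b)\<^sup>2 + (c + d)\<^sup>2 + (a - b)\<^sup>2 + (c - d)\<^sup>2 = 2 * (a\<^sup>2 + c\<^sup>2) + 2 * (b\<^sup>2 + d\<^sup>2)"
  for a b c d :: real
  by (simp add: power2_eq_square algebra_simps)

text \<open>A segment of length zero forces both arcs to be odd multiples of a half turn, in opposite
  directions.\<close>

lemma degenerate_csc:
  assumes v: "norm v \<ge> 4" and "csc_slope v \<alpha> \<beta> \<psi> = 0" "csc_segment v \<alpha> \<beta> \<psi> = 0"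
  obtains \<sigma> :: real where "\<sigma> \<in> {-1, 1}" "sgn (\<psi> - \<alpha>) = \<sigma>" "sgn (\<psi> - \<beta>) = \<sigma>"
    "cos (\<psi> - \<alpha>) = -1" "cos (\<psi> - \<beta>) = -1"
    "v $ 1 * cos \<psi> + v $ 2 * sin \<psi> = 0" "v $ 1 * sin \<psi> - v $ 2 * cos \<psi> = 4 * \<sigma>"
proof -
  define x y where "x = \<psi> - \<alpha>" and "y = \<psi> - \<beta>"
  have X: "v $ 1 * cos \<psi> + v $ 2 * sin \<psi> = sin \<bar>x\<bar> + sin \<bar>y\<bar>"
    and Y: "v $ 1 * sin \<psi> - v $ 2 * cos \<psi> = turn_lever x + turn_lever y"
    using assms(2,3) by (simp_all add: csc_slope_def csc_segment_def x_def y_def)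
  have "16 \<le> (norm v)\<^sup>2"
    using power_mono[OF v, of 2] by simp
  also have "(norm v)\<^sup>2 = (v $ 1)\<^sup>2 + (v $ 2)\<^sup>2"
    by (simp add: norm_vec_def L2_set_def sum_2 sum_nonneg)
  also have "\<dots> = (v $ 1 * cos \<psi> + v $ 2 * sin \<psi>)\<^sup>2 + (v $ 1 * sin \<psi> - v $ 2 * cos \<psi>)\<^sup>2"
    using sum_squares_rotation[of "v $ 1" "cos \<psi>" "v $ 2" "sin \<psi>"] by simp
  finally have *: "16 \<le> (sin \<bar>x\<bar> + sin \<bar>y\<bar>)\<^sup>2 + (turn_lever x + turn_lever y)\<^sup>2"
    unfolding X Y .
  \<comment> \<open>Each chord has squared length \<open>2 - 2 * cos z\<close>, at most 4. Two such
    chords span distance 4 only if they are equal diameters; the parallelogram law extracts this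
    from \<open>*\<close>.\<close>
  have N: "(sin \<bar>z\<bar>)\<^sup>2 + (turn_lever z)\<^sup>2 = 2 - 2 * cos z" for z :: real
  proof -
    have "(sin \<bar>z\<bar>)\<^sup>2 = (sin z)\<^sup>2" by (simp add: abs_if)
    moreover have "(turn_lever z)\<^sup>2 = (1 - cos z)\<^sup>2"
      by (cases "z = 0") (auto simp: turn_lever_def power_mult_distrib sgn_if)
    moreover have "(1 - cos z)\<^sup>2 = 1 + (cos z)\<^sup>2 - 2 * cos z"
      by (simp add: power2_diff)
    ultimately show ?thesis using sin_cos_squared_add[of z] by linarith
  qed
  have le: "-1 \<le> cos x" "-1 \<le> cos y" by simp_all
  have "(sin \<bar>x\<bar> + sin \<bar>y\<bar>)\<^sup>2 + (turn_lever x + turn_lever y)\<^sup>2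
    + (sin \<bar>x\<bar> - sin \<bar>y\<bar>)\<^sup>2 + (turn_lever x - turn_lever y)\<^sup>2 = 8 - 4 * cos x - 4 * cos y"
    unfolding parallelogram_law_2 N by simp
  then have "8 + 4 * cos x + 4 * cos y + (turn_lever x - turn_lever y)\<^sup>2 + (sin \<bar>x\<bar> - sin \<bar>y\<bar>)\<^sup>2 \<le> 0"
    using * by linarith
  then have c: "cos x = -1" "cos y = -1" and "(turn_lever x - turn_lever y)\<^sup>2 = 0"
    using le zero_le_power2[of "turn_lever x - turn_lever y"] zero_le_power2[of "sin \<bar>x\<bar> - sin \<bar>y\<bar>"]
    by linarith+
  then have s: "sgn y = sgn x" by (simp add: turn_lever_def)
  have "x \<noteq> 0" using c(1) by auto
  then have "sgn x \<in> {-1, 1}" by (auto simp: sgn_if)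
  moreover have sin: "sin \<bar>z\<bar> = 0" if "cos z = -1" for z :: real
  proof -
    have "(sin z)\<^sup>2 = 0" using sin_cos_squared_add[of z] unfolding that by simp
    then show ?thesis by (simp add: abs_if)
  qed
  have "v $ 1 * cos \<psi> + v $ 2 * sin \<psi> = 0"
    unfolding X using sin[OF c(1)] sin[OF c(2)] by simp
  moreover have "v $ 1 * sin \<psi> - v $ 2 * cos \<psi> = 4 * sgn x"
    unfolding Y turn_lever_def c s by simp
  ultimately show ?thesis
    using that[of "sgn x"] c s unfolding x_def y_def by blast
qed

text \<open>Both arcs are at least a half turn, so small changes keep their signs and the slope is
  exactly trigonometric. For \<open>\<delta> = 0\<close> it is
  \<open>\<sigma> * 2 * (1 - cos r)\<close>, a double zero without change of sign.\<close>

lemma degenerate_csc_slope: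
  fixes \<sigma> :: real
  assumes \<sigma>: "\<sigma> \<in> {-1, 1}" "sgn (\<psi> - \<alpha>) = \<sigma>" "sgn (\<psi> - \<beta>) = \<sigma>"
    and c: "cos (\<psi> - \<alpha>) = -1" "cos (\<psi> - \<beta>) = -1"
    and v: "v $ 1 * cos \<psi> + v $ 2 * sin \<psi> = 0" "v $ 1 * sin \<psi> - v $ 2 * cos \<psi> = 4 * \<sigma>"
    and r: "\<bar>r\<bar> \<le> 1" "\<bar>\<delta>\<bar> \<le> 1"
  shows "csc_slope v (\<alpha> + \<delta>) \<beta> (\<psi> + r) = \<sigma> * (2 + cos (r - \<delta>) - 3 * cos r)"
proof -
  \<comment> \<open>The bound 2 leaves room for \<open>r - \<delta>\<close>, and
    \<open>2 < pi \<le> \<bar>x\<bar>\<close> preserves the sign.\<close>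
  have lever: "turn_lever (x + d) = \<sigma> * (1 + cos d)"
    if "\<bar>d\<bar> \<le> 2" "sgn x = \<sigma>" "cos x = -1" for x d :: real
  proof -
    have "sgn (x + d) = \<sigma>"
      using that cos_eq_minus_one_imp[of x] pi_gt3 by (auto simp: sgn_if split: if_splits)
    moreover have "sin x = 0"
      using that(3) sin_cos_squared_add[of x] by auto
    ultimately show ?thesis
      using that(3) by (simp add: turn_lever_def cos_add)
  qed
  have "v $ 1 * sin (\<psi> + r) - v $ 2 * cos (\<psi> + r)
    = cos r * (v $ 1 * sin \<psi> - v $ 2 * cos \<psi>) + sin r * (v $ 1 * cos \<psi> + v $ 2 * sin \<psi>)"
    by (simp add: sin_add cos_add algebra_simps)
  also have "\<dots> = 4 * \<sigma> * cos r" using v by simp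
  finally show ?thesis
    using lever[of "r - \<delta>" "\<psi> - \<alpha>"] lever[of r "\<psi> - \<beta>"] assms
    by (simp add: csc_slope_def algebra_simps)
qed

text \<open>This holds because \<open>\<bar>csc_slope\<bar>\<close> increases away from the critical point, on either side; it
  makes the effect of moving the critical point negligible in the first variation.\<close>

lemma csc_length_vs_slope:
  assumes v: "norm v \<ge> 4" and p: "csc_param v \<alpha> \<beta> \<psi>"
  shows "\<exists>r>0. \<forall>z. \<bar>z - \<psi>\<bar> < r \<longrightarrow>
    \<bar>csc_length v \<alpha> \<beta> z - csc_length v \<alpha> \<beta> \<psi>\<bar> \<le> \<bar>z - \<psi>\<bar> * \<bar>csc_slope v \<alpha> \<beta> z\<bar>"
proof -
  let ?f = "csc_slope v \<alpha> \<beta>"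
  have 0: "?f \<psi> = 0" using p by (simp add: csc_param_def)
  have "\<exists>r>0. \<forall>z w. \<bar>z - \<psi>\<bar> < r \<longrightarrow> (w \<in> {\<psi>..z} \<or> w \<in> {z..\<psi>}) \<longrightarrow> \<bar>?f w\<bar> \<le> \<bar>?f z\<bar>"
  proof (cases "csc_segment v \<alpha> \<beta> \<psi> = 0")
    case True
    obtain \<sigma> :: real where \<sigma>: "\<sigma> \<in> {-1, 1}" "sgn (\<psi> - \<alpha>) = \<sigma>" "sgn (\<psi> - \<beta>) = \<sigma>"
      "cos (\<psi> - \<alpha>) = -1" "cos (\<psi> - \<beta>) = -1"
      "v $ 1 * cos \<psi> + v $ 2 * sin \<psi> = 0" "v $ 1 * sin \<psi> - v $ 2 * cos \<psi> = 4 * \<sigma>"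
      using degenerate_csc[OF v 0 True] .
    have abs: "\<bar>?f z\<bar> = 2 * (1 - cos \<bar>z - \<psi>\<bar>)" if "\<bar>z - \<psi>\<bar> < 1" for z
    proof -
      have "?f z = \<sigma> * (2 * (1 - cos (z - \<psi>)))"
        using degenerate_csc_slope[OF \<sigma>, of "z - \<psi>" 0] that by simp
      moreover have "\<bar>\<sigma>\<bar> = 1" using \<sigma>(1) by auto
      ultimately show ?thesis by (simp add: abs_mult)
    qed
    show ?thesis
    proof (intro exI[of _ 1] conjI allI impI)
      fix z w assume z: "\<bar>z - \<psi>\<bar> < 1" and w: "w \<in> {\<psi>..z} \<or> w \<in> {z..\<psi>}"
      then have le: "\<bar>w - \<psi>\<bar> \<le> \<bar>z - \<psi>\<bar>" by auto
      then have "cos \<bar>z - \<psi>\<bar> \<le> cos \<bar>w - \<psi>\<bar>"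
        using z pi_gt3 by (intro cos_monotone_0_pi_le) auto
      then show "\<bar>?f w\<bar> \<le> \<bar>?f z\<bar>" using abs[of z] abs[of w] z le by simp
    qed simp
  next
    case False
    then have "csc_segment v \<alpha> \<beta> \<psi> > 0" using p by (simp add: csc_param_def)
    from csc_segment_pos_nearby[OF this] obtain r where
      r: "r > 0" "\<And>z. \<bar>z - \<psi>\<bar> < r \<Longrightarrow> csc_segment v \<alpha> \<beta> z > 0" by blast
    have mono: "?f b \<le> ?f a" if "a \<le> b" "\<bar>a - \<psi>\<bar> < r" "\<bar>b - \<psi>\<bar> < r" for a b
    proof (rule DERIV_nonpos_imp_nonincreasing[OF that(1)])
      fix x assume "a \<le> x" "x \<le> b"
      then have "csc_segment v \<alpha> \<beta> x > 0" using that by (intro r(2)) auto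
      then show "\<exists>y. (?f has_real_derivative y) (at x) \<and> y \<le> 0"
        by (intro exI[of _ "- csc_segment v \<alpha> \<beta> x"]) (simp add: csc_slope_deriv)
    qed
    show ?thesis
    proof (intro exI[of _ r] conjI allI impI)
      fix z w assume z: "\<bar>z - \<psi>\<bar> < r" and w: "w \<in> {\<psi>..z} \<or> w \<in> {z..\<psi>}"
      from w show "\<bar>?f w\<bar> \<le> \<bar>?f z\<bar>"
      proof
        assume "w \<in> {\<psi>..z}"
        then show ?thesis using mono[of w z] mono[of \<psi> w] z 0 r(1) by auto
      next
        assume "w \<in> {z..\<psi>}"
        then show ?thesis using mono[of z w] mono[of w \<psi>] z 0 r(1) by auto
      qed
    qed fact
  qed
  then obtain r where r: "r > 0"
    "\<And>z w. \<bar>z - \<psi>\<bar> < r \<Longrightarrow> (w \<in> {\<psi>..z} \<or> w \<in> {z..\<psi>}) \<Longrightarrow> \<bar>?f w\<bar> \<le> \<bar>?f z\<bar>"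
    by blast
  show ?thesis
  proof (intro exI[of _ r] conjI allI impI)
    fix z assume z: "\<bar>z - \<psi>\<bar> < r"
    \<comment> \<open>The mean value theorem produces the slope at an intermediate \<open>w\<close>;
      the monotonicity just obtained replaces \<open>w\<close> by the end point
      \<open>z\<close>.\<close>
    have "\<exists>w. (w \<in> {\<psi>..z} \<or> w \<in> {z..\<psi>}) \<and>
       csc_length v \<alpha> \<beta> z - csc_length v \<alpha> \<beta> \<psi> = (z - \<psi>) * ?f w"
    proof (cases "z = \<psi>")
      case False
      then show ?thesis
      proof (cases "\<psi> < z")
        case True
        from MVT2[OF this csc_length_deriv, of v \<alpha> \<beta>] obtain w where
          "\<psi> < w" "w < z" "csc_length v \<alpha> \<beta> z - csc_length v \<alpha> \<beta> \<psi> = (z - \<psi>) * ?f w" by blast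
        then show ?thesis by (intro exI[of _ w]) auto
      next
        case F: False
        with False have "z < \<psi>" by simp
        from MVT2[OF this csc_length_deriv, of v \<alpha> \<beta>] obtain w where
          "z < w" "w < \<psi>" "csc_length v \<alpha> \<beta> \<psi> - csc_length v \<alpha> \<beta> z = (\<psi> - z) * ?f w" by blast
        then show ?thesis by (intro exI[of _ w]) (auto simp: algebra_simps)
      qed
    qed auto
    then obtain w where "w \<in> {\<psi>..z} \<or> w \<in> {z..\<psi>}"
      and eq: "csc_length v \<alpha> \<beta> z - csc_length v \<alpha> \<beta> \<psi> = (z - \<psi>) * ?f w" by blast
    then have "\<bar>?f w\<bar> \<le> \<bar>?f z\<bar>" using r(2) z by blast
    then show "\<bar>csc_length v \<alpha> \<beta> z - csc_length v \<alpha> \<beta> \<psi>\<bar> \<le> \<bar>z - \<psi>\<bar> * \<bar>?f z\<bar>"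
      unfolding eq abs_mult by (intro mult_left_mono) auto
  qed fact
qed

text \<open>First the direction moves at fixed \<open>t\<^sub>0\<close>, then the heading moves at
  fixed \<open>\<psi>\<close>. The slope vanishes at \<open>t\<close> and is 1-Lipschitz in the
  heading, so at \<open>t\<^sub>0\<close> it is at most \<open>\<bar>t - t\<^sub>0\<bar>\<close>,
  and the first move costs only a product of two small quantities. No rate at which
  \<open>\<psi>\<close> approaches \<open>\<psi>\<^sub>0\<close> enters.\<close>

lemma csc_length_first_variation:
  assumes "norm v \<ge> 4" and "csc_param v t\<^sub>0 \<beta> \<psi>\<^sub>0"
  shows "\<exists>r>0. \<forall>t \<psi>. \<bar>\<psi> - \<psi>\<^sub>0\<bar> < r \<and> csc_param v t \<beta> \<psi> \<longrightarrow>
    \<bar>csc_length v t \<beta> \<psi> - csc_length v t\<^sub>0 \<beta> \<psi>\<^sub>0 + turn_lever (\<psi>\<^sub>0 - t\<^sub>0) * (t - t\<^sub>0)\<bar>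
      \<le> \<bar>t - t\<^sub>0\<bar> * (\<bar>t - t\<^sub>0\<bar> + 2 * \<bar>\<psi> - \<psi>\<^sub>0\<bar>)"
proof -
  from csc_length_vs_slope[OF assms] obtain r where r: "r > 0"
    "\<And>z. \<bar>z - \<psi>\<^sub>0\<bar> < r \<Longrightarrow> \<bar>csc_length v t\<^sub>0 \<beta> z - csc_length v t\<^sub>0 \<beta> \<psi>\<^sub>0\<bar>
       \<le> \<bar>z - \<psi>\<^sub>0\<bar> * \<bar>csc_slope v t\<^sub>0 \<beta> z\<bar>" by blast
  show ?thesis
  proof (intro exI[of _ r] conjI allI impI)
    fix t \<psi> assume "\<bar>\<psi> - \<psi>\<^sub>0\<bar> < r \<and> csc_param v t \<beta> \<psi>"
    then have \<psi>: "\<bar>\<psi> - \<psi>\<^sub>0\<bar> < r" and p: "csc_slope v t \<beta> \<psi> = 0"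
      by (auto simp: csc_param_def)
    have "\<bar>csc_length v t\<^sub>0 \<beta> \<psi> - csc_length v t\<^sub>0 \<beta> \<psi>\<^sub>0\<bar> \<le> \<bar>\<psi> - \<psi>\<^sub>0\<bar> * \<bar>csc_slope v t\<^sub>0 \<beta> \<psi>\<bar>"
      by (rule r(2)[OF \<psi>])
    also have "\<dots> \<le> \<bar>\<psi> - \<psi>\<^sub>0\<bar> * \<bar>t - t\<^sub>0\<bar>"
      using csc_slope_lipschitz[of v t \<beta> \<psi> t\<^sub>0] p by (intro mult_left_mono) auto
    finally have 1: "\<bar>csc_length v t\<^sub>0 \<beta> \<psi> - csc_length v t\<^sub>0 \<beta> \<psi>\<^sub>0\<bar> \<le> \<bar>\<psi> - \<psi>\<^sub>0\<bar> * \<bar>t - t\<^sub>0\<bar>" .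
    \<comment> \<open>With the linear term added, the derivative in the heading is a difference of
      two levers, which is small because the lever is 1-Lipschitz.\<close>
    have "norm ((turn_cost (\<psi> - t) + turn_lever (\<psi>\<^sub>0 - t\<^sub>0) * t) -
       (turn_cost (\<psi> - t\<^sub>0) + turn_lever (\<psi>\<^sub>0 - t\<^sub>0) * t\<^sub>0))
      \<le> (\<bar>t - t\<^sub>0\<bar> + \<bar>\<psi> - \<psi>\<^sub>0\<bar>) * norm (t - t\<^sub>0)"
    proof (rule field_differentiable_bound[of "closed_segment t\<^sub>0 t"])
      fix z assume "z \<in> closed_segment t\<^sub>0 t"
      then have z: "\<bar>z - t\<^sub>0\<bar> \<le> \<bar>t - t\<^sub>0\<bar>"
        by (auto simp: closed_segment_eq_real_ivl split: if_splits)
      show "((\<lambda>s. turn_cost (\<psi> - s) + turn_lever (\<psi>\<^sub>0 - t\<^sub>0) * s) has_field_derivative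
        turn_lever (\<psi>\<^sub>0 - t\<^sub>0) - turn_lever (\<psi> - z)) (at z within closed_segment t\<^sub>0 t)"
        by (auto intro!: derivative_eq_intros)
      show "norm (turn_lever (\<psi>\<^sub>0 - t\<^sub>0) - turn_lever (\<psi> - z)) \<le> \<bar>t - t\<^sub>0\<bar> + \<bar>\<psi> - \<psi>\<^sub>0\<bar>"
        using turn_lever_lipschitz[of "\<psi>\<^sub>0 - t\<^sub>0" "\<psi> - z"] z by simp
    qed auto
    then have 2: "\<bar>(turn_cost (\<psi> - t) + turn_lever (\<psi>\<^sub>0 - t\<^sub>0) * t) -
       (turn_cost (\<psi> - t\<^sub>0) + turn_lever (\<psi>\<^sub>0 - t\<^sub>0) * t\<^sub>0)\<bar>
      \<le> (\<bar>t - t\<^sub>0\<bar> + \<bar>\<psi> - \<psi>\<^sub>0\<bar>) * \<bar>t - t\<^sub>0\<bar>" by simp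
    have "csc_length v t \<beta> \<psi> - csc_length v t\<^sub>0 \<beta> \<psi>\<^sub>0 + turn_lever (\<psi>\<^sub>0 - t\<^sub>0) * (t - t\<^sub>0) =
       ((turn_cost (\<psi> - t) + turn_lever (\<psi>\<^sub>0 - t\<^sub>0) * t) -
       (turn_cost (\<psi> - t\<^sub>0) + turn_lever (\<psi>\<^sub>0 - t\<^sub>0) * t\<^sub>0))
       + (csc_length v t\<^sub>0 \<beta> \<psi> - csc_length v t\<^sub>0 \<beta> \<psi>\<^sub>0)"
      by (simp add: csc_length_def algebra_simps)
    then have "\<bar>csc_length v t \<beta> \<psi> - csc_length v t\<^sub>0 \<beta> \<psi>\<^sub>0 + turn_lever (\<psi>\<^sub>0 - t\<^sub>0) * (t - t\<^sub>0)\<bar>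
      \<le> (\<bar>t - t\<^sub>0\<bar> + \<bar>\<psi> - \<psi>\<^sub>0\<bar>) * \<bar>t - t\<^sub>0\<bar> + \<bar>\<psi> - \<psi>\<^sub>0\<bar> * \<bar>t - t\<^sub>0\<bar>"
      using add_mono[OF 2 1] abs_triangle_ineq by (metis order_trans)
    then show "\<bar>csc_length v t \<beta> \<psi> - csc_length v t\<^sub>0 \<beta> \<psi>\<^sub>0 + turn_lever (\<psi>\<^sub>0 - t\<^sub>0) * (t - t\<^sub>0)\<bar>
      \<le> \<bar>t - t\<^sub>0\<bar> * (\<bar>t - t\<^sub>0\<bar> + 2 * \<bar>\<psi> - \<psi>\<^sub>0\<bar>)"
      by (simp add: algebra_simps)
  qed fact
qed

section \<open>Critical points for nearby headings\<close>

text \<open>At the first point where \<open>f \<le> 0\<close> the function arrives from positive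
  values, so it cannot be increasing there. For the slope, \<open>f' \<le> 0\<close> says that the
  segment has nonnegative length.\<close>

lemma first_zero_nonincreasing:
  fixes f f' :: "real \<Rightarrow> real"
  assumes "a \<le> b" and d: "\<And>z. (f has_real_derivative f' z) (at z)" and "f a > 0" "f b \<le> 0"
  shows "\<exists>z\<in>{a..b}. f z = 0 \<and> f' z \<le> 0"
proof -
  have c: "continuous_on A f" for A
    using d DERIV_isCont continuous_at_imp_continuous_on by blast
  have "compact ({a..b} \<inter> {z. f z \<le> 0})"
    using c by (intro compact_Int_closed compact_Icc closed_Collect_le) auto
  then have "compact {z\<in>{a..b}. f z \<le> 0}"
    by (simp add: Int_def)
  moreover have "{z\<in>{a..b}. f z \<le> 0} \<noteq> {}" using assms by auto
  ultimately obtain z where z: "a \<le> z" "z \<le> b" "f z \<le> 0"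
    and min: "\<And>y. a \<le> y \<Longrightarrow> y \<le> b \<Longrightarrow> f y \<le> 0 \<Longrightarrow> z \<le> y"
    using compact_attains_inf[of "{z\<in>{a..b}. f z \<le> 0}"] by auto
  have "\<exists>y\<ge>a. y \<le> z \<and> f y = 0"
    using z assms d DERIV_isCont by (intro IVT2) (auto intro: less_imp_le)
  then have fz: "f z = 0" using min z by (metis dual_order.trans order_antisym order_refl)
  then have "a < z" using z assms by (metis less_irrefl order_le_less)
  have "f' z \<le> 0"
  proof (rule ccontr)
    assume "\<not> f' z \<le> 0"
    then obtain e where e: "e > 0" "\<And>h. h > 0 \<Longrightarrow> h < e \<Longrightarrow> f (z - h) < f z"
      using DERIV_pos_inc_left[OF d, of z] by auto
    define h where "h = min (e / 2) (z - a)"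
    have "h > 0" "h < e" "h \<le> z - a" using \<open>a < z\<close> e(1) by (auto simp: h_def)
    then show False using e(2)[of h] min[of "z - h"] fz z by auto
  qed
  then show ?thesis using fz z by auto
qed

text \<open>Reflection of the previous lemma. Between them, the function may vanish at either end of
  the interval, as the slope does at a degenerate critical point.\<close>

lemma last_zero_nonincreasing:
  fixes f f' :: "real \<Rightarrow> real"
  assumes "a \<le> b" and d: "\<And>z. (f has_real_derivative f' z) (at z)" and "f a \<ge> 0" "f b < 0"
  shows "\<exists>z\<in>{a..b}. f z = 0 \<and> f' z \<le> 0"
proof -
  have "\<exists>z\<in>{-b..-a}. - f (- z) = 0 \<and> f' (- z) \<le> 0"
  proof (rule first_zero_nonincreasing)
    show "((\<lambda>z. - f (- z)) has_real_derivative f' (- z)) (at z)" for z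
      by (auto intro!: derivative_eq_intros DERIV_chain2[OF d])
  qed (use assms in auto)
  then obtain z where "z \<in> {-b..-a}" "f (- z) = 0" "f' (- z) \<le> 0" by auto
  then show ?thesis by (intro bexI[of _ "- z"]) auto
qed

text \<open>A fixed interval, around \<open>\<psi>\<^sub>0\<close> or ending there, is found on
  which the slope falls through zero for every \<open>t\<close> near \<open>t\<^sub>0\<close>; the
  zero found there has a segment of nonnegative length.\<close>

lemma csc_param_nearby:
  assumes v: "norm v \<ge> 4" and p: "csc_param v t\<^sub>0 \<beta> \<psi>\<^sub>0" and "\<epsilon> > 0"
  shows "\<exists>\<delta>>0. \<forall>t. \<bar>t - t\<^sub>0\<bar> < \<delta> \<longrightarrow> (\<exists>\<psi>. \<bar>\<psi> - \<psi>\<^sub>0\<bar> < \<epsilon> \<and> csc_param v t \<beta> \<psi>)"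
proof -
  let ?f = "\<lambda>t. csc_slope v t \<beta>"
  have 0: "?f t\<^sub>0 \<psi>\<^sub>0 = 0" using p by (simp add: csc_param_def)
  have "\<exists>\<delta>>0. \<exists>a b. \<psi>\<^sub>0 - \<epsilon> < a \<and> a \<le> b \<and> b < \<psi>\<^sub>0 + \<epsilon> \<and>
    (\<forall>t. \<bar>t - t\<^sub>0\<bar> < \<delta> \<longrightarrow> ?f t a > 0 \<and> ?f t b \<le> 0 \<or> ?f t a \<ge> 0 \<and> ?f t b < 0)"
  proof (cases "csc_segment v t\<^sub>0 \<beta> \<psi>\<^sub>0 = 0")
    case True
    obtain \<sigma> :: real where \<sigma>: "\<sigma> \<in> {-1, 1}" "sgn (\<psi>\<^sub>0 - t\<^sub>0) = \<sigma>" "sgn (\<psi>\<^sub>0 - \<beta>) = \<sigma>"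
      "cos (\<psi>\<^sub>0 - t\<^sub>0) = -1" "cos (\<psi>\<^sub>0 - \<beta>) = -1"
      "v $ 1 * cos \<psi>\<^sub>0 + v $ 2 * sin \<psi>\<^sub>0 = 0" "v $ 1 * sin \<psi>\<^sub>0 - v $ 2 * cos \<psi>\<^sub>0 = 4 * \<sigma>"
      using degenerate_csc[OF v 0 True] .
    define h where "h = min 1 \<epsilon> / 2"
    have h: "0 < h" "h < \<epsilon>" "h \<le> 1" using \<open>\<epsilon> > 0\<close> by (auto simp: h_def)
    \<comment> \<open>For \<open>t\<^sub>0\<close> the slope at distance \<open>h\<close> is
      \<open>\<sigma> * 2 * (1 - cos h)\<close>, and it is 1-Lipschitz in the heading, so its sign
      survives. The bound 1 is the range of \<open>degenerate_csc_slope\<close>.\<close>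
    define \<delta> where "\<delta> = min 1 (2 * (1 - cos h))"
    have ch: "cos h < 1" using cos_monotone_0_pi[of 0 h] h pi_gt3 by auto
    then have "\<delta> > 0" by (simp add: \<delta>_def)
    have at0: "?f t \<psi>\<^sub>0 = \<sigma> * (cos (t - t\<^sub>0) - 1)" if "\<bar>t - t\<^sub>0\<bar> < \<delta>" for t
      using degenerate_csc_slope[OF \<sigma>, of 0 "t - t\<^sub>0"] that by (simp add: \<delta>_def cos_diff)
    have ath: "\<bar>?f t (\<psi>\<^sub>0 + r) - \<sigma> * (2 * (1 - cos h))\<bar> < 2 * (1 - cos h)"
      if t: "\<bar>t - t\<^sub>0\<bar> < \<delta>" and r: "\<bar>r\<bar> = h" for t r
    proof -
      have "cos r = cos h" using r by (metis cos_abs_real)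
      then have "?f t\<^sub>0 (\<psi>\<^sub>0 + r) = \<sigma> * (2 * (1 - cos h))"
        using degenerate_csc_slope[OF \<sigma>, of r 0] r h by simp
      then show ?thesis
        using csc_slope_lipschitz[of v t \<beta> "\<psi>\<^sub>0 + r" t\<^sub>0] t unfolding \<delta>_def by linarith
    qed
    \<comment> \<open>At \<open>\<psi>\<^sub>0\<close> the slope is zero or has sign opposite to
      \<open>\<sigma>\<close>, while at distance \<open>h\<close> it has sign
      \<open>\<sigma>\<close>. It has to fall, so the interval lies to the left for
      \<open>\<sigma> = 1\<close> and to the right for \<open>\<sigma> = -1\<close>.\<close>
    show ?thesis
    proof (cases "\<sigma> = 1")
      case True
      have "?f t (\<psi>\<^sub>0 - h) > 0" "?f t \<psi>\<^sub>0 \<le> 0" if "\<bar>t - t\<^sub>0\<bar> < \<delta>" for t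
        using at0[OF that] ath[OF that, of "- h"] h True by auto
      then show ?thesis
        using h \<open>\<delta> > 0\<close> by (intro exI[of _ \<delta>] conjI exI[of _ "\<psi>\<^sub>0 - h"] exI[of _ \<psi>\<^sub>0]) auto
    next
      case False
      then have "\<sigma> = -1" using \<sigma>(1) by auto
      then have "?f t (\<psi>\<^sub>0 + h) < 0" "?f t \<psi>\<^sub>0 \<ge> 0" if "\<bar>t - t\<^sub>0\<bar> < \<delta>" for t
        using at0[OF that] ath[OF that, of h] h by auto
      then show ?thesis
        using h \<open>\<delta> > 0\<close> by (intro exI[of _ \<delta>] conjI exI[of _ \<psi>\<^sub>0] exI[of _ "\<psi>\<^sub>0 + h"]) auto
    qed
  next
    case False
    then have "- csc_segment v t\<^sub>0 \<beta> \<psi>\<^sub>0 < 0" using p by (simp add: csc_param_def)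
    from DERIV_neg_dec_left[OF csc_slope_deriv this] DERIV_neg_dec_right[OF csc_slope_deriv this]
    obtain d d' where d: "d > 0" "\<And>h. h > 0 \<Longrightarrow> h < d \<Longrightarrow> ?f t\<^sub>0 (\<psi>\<^sub>0 - h) > 0"
      "d' > 0" "\<And>h. h > 0 \<Longrightarrow> h < d' \<Longrightarrow> ?f t\<^sub>0 (\<psi>\<^sub>0 + h) < 0" unfolding 0 by blast
    define h where "h = Min {d, d', \<epsilon>} / 2"
    have h: "h > 0" "h < d" "h < d'" "h < \<epsilon>"
      using d(1,3) \<open>\<epsilon> > 0\<close> by (auto simp: h_def min_def)
    \<comment> \<open>The smaller of the margins by which the slope misses zero at the two
      ends.\<close>
    define \<delta> where "\<delta> = min (?f t\<^sub>0 (\<psi>\<^sub>0 - h)) (- ?f t\<^sub>0 (\<psi>\<^sub>0 + h))"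
    have "\<delta> > 0" using d(2,4)[of h] h by (simp add: \<delta>_def)
    moreover have "?f t (\<psi>\<^sub>0 - h) > 0 \<and> ?f t (\<psi>\<^sub>0 + h) \<le> 0" if "\<bar>t - t\<^sub>0\<bar> < \<delta>" for t
      using csc_slope_lipschitz[of v t \<beta> "\<psi>\<^sub>0 - h" t\<^sub>0] csc_slope_lipschitz[of v t \<beta> "\<psi>\<^sub>0 + h" t\<^sub>0] that
      by (auto simp: \<delta>_def)
    ultimately show ?thesis
      using h by (intro exI[of _ \<delta>] conjI exI[of _ "\<psi>\<^sub>0 - h"] exI[of _ "\<psi>\<^sub>0 + h"]) auto
  qed
  then obtain \<delta> a b where ab: "\<delta> > 0" "\<psi>\<^sub>0 - \<epsilon> < a" "a \<le> b" "b < \<psi>\<^sub>0 + \<epsilon>"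
    and sgn: "\<And>t. \<bar>t - t\<^sub>0\<bar> < \<delta> \<Longrightarrow> ?f t a > 0 \<and> ?f t b \<le> 0 \<or> ?f t a \<ge> 0 \<and> ?f t b < 0" by blast
  show ?thesis
  proof (rule exI[of _ \<delta>], intro conjI allI impI)
    fix t assume "\<bar>t - t\<^sub>0\<bar> < \<delta>"
    from sgn[OF this] have "\<exists>z\<in>{a..b}. ?f t z = 0 \<and> - csc_segment v t \<beta> z \<le> 0"
      using first_zero_nonincreasing[OF ab(3) csc_slope_deriv, of v t \<beta>]
        last_zero_nonincreasing[OF ab(3) csc_slope_deriv, of v t \<beta>] by blast
    then obtain z where z: "a \<le> z" "z \<le> b" and "csc_param v t \<beta> z"
      by (auto simp: csc_param_def)
    moreover have "\<bar>z - \<psi>\<^sub>0\<bar> < \<epsilon>" using ab z by auto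
    ultimately show "\<exists>\<psi>. \<bar>\<psi> - \<psi>\<^sub>0\<bar> < \<epsilon> \<and> csc_param v t \<beta> \<psi>" by blast
  qed fact
qed

section \<open>Minimising over the critical points\<close>

text \<open>\<open>K\<close> is a Frechet supergradient of \<open>f\<close> at
  \<open>t\<^sub>0\<close>. For a minimum over candidates such a bound follows from tracking one
  minimiser, whereas a bound from below involves all of them.\<close>

definition upper_linear :: "(real \<Rightarrow> real) \<Rightarrow> real \<Rightarrow> real \<Rightarrow> bool" where
  "upper_linear f K t\<^sub>0 \<longleftrightarrow>
     (\<forall>\<epsilon>>0. \<forall>\<^sub>F t in nhds t\<^sub>0. f t \<le> f t\<^sub>0 + K * (t - t\<^sub>0) + \<epsilon> * \<bar>t - t\<^sub>0\<bar>)"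

lemma upper_linear_add:
  assumes "upper_linear f K t\<^sub>0" "upper_linear g M t\<^sub>0"
  shows "upper_linear (\<lambda>t. f t + g t) (K + M) t\<^sub>0"
  unfolding upper_linear_def
proof (intro allI impI)
  fix \<epsilon> :: real assume "\<epsilon> > 0"
  then have "\<epsilon> / 2 > 0" by simp
  then have "\<forall>\<^sub>F t in nhds t\<^sub>0. f t \<le> f t\<^sub>0 + K * (t - t\<^sub>0) + \<epsilon> / 2 * \<bar>t - t\<^sub>0\<bar>"
    "\<forall>\<^sub>F t in nhds t\<^sub>0. g t \<le> g t\<^sub>0 + M * (t - t\<^sub>0) + \<epsilon> / 2 * \<bar>t - t\<^sub>0\<bar>"
    using assms unfolding upper_linear_def by blast+
  then show "\<forall>\<^sub>F t in nhds t\<^sub>0. f t + g t \<le> f t\<^sub>0 + g t\<^sub>0 + (K + M) * (t - t\<^sub>0) + \<epsilon> * \<bar>t - t\<^sub>0\<bar>"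
    by eventually_elim (simp add: algebra_simps)
qed

lemma upper_linear_const: "upper_linear (\<lambda>_. c) 0 t\<^sub>0"
  by (simp add: upper_linear_def)

text \<open>Difference quotients from the right give \<open>D \<le> K\<close>; from the left the
  division by a negative number gives \<open>K \<le> D\<close>.\<close>

lemma upper_linear_derivative_unique:
  assumes u: "upper_linear f K t\<^sub>0" and d: "(f has_real_derivative D) (at t\<^sub>0)"
  shows "D = K"
proof -
  have lim: "((\<lambda>t. (f t - f t\<^sub>0) / (t - t\<^sub>0)) \<longlongrightarrow> D) (at t\<^sub>0)"
    using d by (simp add: has_field_derivative_iff)
  have "\<bar>D - K\<bar> \<le> \<epsilon>" if "\<epsilon> > 0" for \<epsilon>
  proof -
    have ev: "\<forall>\<^sub>F t in nhds t\<^sub>0. f t \<le> f t\<^sub>0 + K * (t - t\<^sub>0) + \<epsilon> * \<bar>t - t\<^sub>0\<bar>"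
      using u that by (simp add: upper_linear_def)
    have "D \<le> K + \<epsilon>"
    proof (rule tendsto_upperbound)
      show "((\<lambda>t. (f t - f t\<^sub>0) / (t - t\<^sub>0)) \<longlongrightarrow> D) (at_right t\<^sub>0)"
        using lim by (simp add: filterlim_at_split)
      show "\<forall>\<^sub>F t in at_right t\<^sub>0. (f t - f t\<^sub>0) / (t - t\<^sub>0) \<le> K + \<epsilon>"
        unfolding eventually_at_filter using ev
        by eventually_elim (auto simp: divide_simps algebra_simps)
    qed simp
    moreover have "K - \<epsilon> \<le> D"
    proof (rule tendsto_lowerbound)
      show "((\<lambda>t. (f t - f t\<^sub>0) / (t - t\<^sub>0)) \<longlongrightarrow> D) (at_left t\<^sub>0)"
        using lim by (simp add: filterlim_at_split)
      show "\<forall>\<^sub>F t in at_left t\<^sub>0. K - \<epsilon> \<le> (f t - f t\<^sub>0) / (t - t\<^sub>0)"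
        unfolding eventually_at_filter using ev
        by eventually_elim (auto simp: divide_simps algebra_simps)
    qed simp
    ultimately show ?thesis by linarith
  qed
  then have "\<bar>D - K\<bar> \<le> 0" by (rule field_le_epsilon) simp
  then show ?thesis by simp
qed

text \<open>A minimising critical point is followed to nearby headings with its number
  \<open>m\<^sub>0\<close> of full turns fixed; \<open>len t\<close> is at most the length there,
  whose first variation is known. Stated for an abstract \<open>len\<close>, this serves the
  variation of either heading.\<close>

lemma csc_min_upper_linear:
  fixes len :: "real \<Rightarrow> real" and m\<^sub>0 :: int
  assumes v: "norm v \<ge> 4"
    and le: "\<And>t \<psi> m::int. csc_param v t (\<beta> + 2 * pi * m) \<psi> \<Longrightarrow> len t \<le> csc_length v t (\<beta> + 2 * pi * m) \<psi>"
    and p: "csc_param v t\<^sub>0 (\<beta> + 2 * pi * m\<^sub>0) \<psi>\<^sub>0" "len t\<^sub>0 = csc_length v t\<^sub>0 (\<beta> + 2 * pi * m\<^sub>0) \<psi>\<^sub>0"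
  shows "upper_linear len (- turn_lever (\<psi>\<^sub>0 - t\<^sub>0)) t\<^sub>0"
  unfolding upper_linear_def
proof (intro allI impI)
  fix \<epsilon> :: real assume \<epsilon>: "\<epsilon> > 0"
  define B where "B = \<beta> + 2 * pi * m\<^sub>0"
  obtain r where r: "r > 0" "\<And>t \<psi>. \<bar>\<psi> - \<psi>\<^sub>0\<bar> < r \<Longrightarrow> csc_param v t B \<psi> \<Longrightarrow>
    \<bar>csc_length v t B \<psi> - csc_length v t\<^sub>0 B \<psi>\<^sub>0 + turn_lever (\<psi>\<^sub>0 - t\<^sub>0) * (t - t\<^sub>0)\<bar>
      \<le> \<bar>t - t\<^sub>0\<bar> * (\<bar>t - t\<^sub>0\<bar> + 2 * \<bar>\<psi> - \<psi>\<^sub>0\<bar>)"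
    using csc_length_first_variation[OF v p(1)] unfolding B_def by blast
  \<comment> \<open>Together with \<open>\<bar>t - t\<^sub>0\<bar> < \<epsilon> / 2\<close> this
    keeps the error factor \<open>\<bar>t - t\<^sub>0\<bar> + 2 * \<bar>\<psi> -
    \<psi>\<^sub>0\<bar>\<close> below \<open>\<epsilon>\<close>.\<close>
  define \<eta> where "\<eta> = min r (\<epsilon> / 4)"
  have \<eta>: "\<eta> > 0" "\<eta> \<le> r" "\<eta> \<le> \<epsilon> / 4" using r \<epsilon> by (auto simp: \<eta>_def)
  obtain \<delta> where \<delta>: "\<delta> > 0"
    "\<And>t. \<bar>t - t\<^sub>0\<bar> < \<delta> \<Longrightarrow> \<exists>\<psi>. \<bar>\<psi> - \<psi>\<^sub>0\<bar> < \<eta> \<and> csc_param v t B \<psi>"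
    using csc_param_nearby[OF v p(1) \<eta>(1)] unfolding B_def by blast
  show "\<forall>\<^sub>F t in nhds t\<^sub>0. len t \<le> len t\<^sub>0 + - turn_lever (\<psi>\<^sub>0 - t\<^sub>0) * (t - t\<^sub>0) + \<epsilon> * \<bar>t - t\<^sub>0\<bar>"
    unfolding eventually_nhds_metric
  proof (intro exI[of _ "min \<delta> (\<epsilon> / 2)"] conjI allI impI)
    fix t assume "dist t t\<^sub>0 < min \<delta> (\<epsilon> / 2)"
    then have t: "\<bar>t - t\<^sub>0\<bar> < \<delta>" "\<bar>t - t\<^sub>0\<bar> < \<epsilon> / 2" by (auto simp: dist_real_def)
    obtain \<psi> where \<psi>: "\<bar>\<psi> - \<psi>\<^sub>0\<bar> < \<eta>" "csc_param v t B \<psi>" using \<delta>(2)[OF t(1)] by blast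
    have "\<bar>t - t\<^sub>0\<bar> * (\<bar>t - t\<^sub>0\<bar> + 2 * \<bar>\<psi> - \<psi>\<^sub>0\<bar>) \<le> \<bar>t - t\<^sub>0\<bar> * \<epsilon>"
      using t \<psi> \<eta> by (intro mult_left_mono) auto
    moreover have "len t \<le> csc_length v t B \<psi>" using le \<psi>(2) unfolding B_def by blast
    moreover have "len t\<^sub>0 = csc_length v t\<^sub>0 B \<psi>\<^sub>0" using p(2) by (simp add: B_def)
    ultimately show "len t \<le> len t\<^sub>0 + - turn_lever (\<psi>\<^sub>0 - t\<^sub>0) * (t - t\<^sub>0) + \<epsilon> * \<bar>t - t\<^sub>0\<bar>"
      using r(2)[of \<psi> t] \<psi> \<eta> by (simp add: abs_le_iff mult.commute)
  qed (use \<delta> \<epsilon> in auto)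
qed

text \<open>Along headings with bad difference quotients, the minimising parameters have a
  convergent subsequence. Its limit is a minimiser at \<open>t\<^sub>0\<close>, so its lever is
  \<open>\<kappa>\<close>, and the first variation around it contradicts the choice of
  headings.\<close>

lemma csc_min_has_derivative:
  fixes len :: "real \<Rightarrow> real"
  assumes v: "norm v \<ge> 4"
    and le: "\<And>t \<psi> m::int. csc_param v t (\<beta> + 2 * pi * m) \<psi> \<Longrightarrow> len t \<le> csc_length v t (\<beta> + 2 * pi * m) \<psi>"
    and attained: "\<And>t. \<exists>\<psi> m::int. csc_param v t (\<beta> + 2 * pi * m) \<psi> \<and>
        len t = csc_length v t (\<beta> + 2 * pi * m) \<psi>"
    and unique: "\<And>\<psi> m::int. csc_param v t\<^sub>0 (\<beta> + 2 * pi * m) \<psi> \<Longrightarrow>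
        len t\<^sub>0 = csc_length v t\<^sub>0 (\<beta> + 2 * pi * m) \<psi> \<Longrightarrow> turn_lever (\<psi> - t\<^sub>0) = \<kappa>"
  shows "(len has_real_derivative - \<kappa>) (at t\<^sub>0)"
  unfolding has_field_derivative_iff
proof (rule tendstoI, rule ccontr)
  fix \<epsilon> :: real assume \<epsilon>: "\<epsilon> > 0"
  assume not: "\<not> (\<forall>\<^sub>F t in at t\<^sub>0. dist ((len t - len t\<^sub>0) / (t - t\<^sub>0)) (- \<kappa>) < \<epsilon>)"
  obtain \<psi>\<^sub>0 and m\<^sub>0 :: int where p0: "csc_param v t\<^sub>0 (\<beta> + 2 * pi * m\<^sub>0) \<psi>\<^sub>0"
    "len t\<^sub>0 = csc_length v t\<^sub>0 (\<beta> + 2 * pi * m\<^sub>0) \<psi>\<^sub>0" using attained by blast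
  have "upper_linear len (- \<kappa>) t\<^sub>0"
    using csc_min_upper_linear[OF v le p0] unique[OF p0] by simp
  \<comment> \<open>The value 1 is arbitrary: the aim is only a majorant of \<open>len (X n)\<close>
    that tends to \<open>len t\<^sub>0\<close>, as continuity of \<open>len\<close> is not yet
    known.\<close>
  then have "\<forall>\<^sub>F t in nhds t\<^sub>0. len t \<le> len t\<^sub>0 + - \<kappa> * (t - t\<^sub>0) + 1 * \<bar>t - t\<^sub>0\<bar>"
    unfolding upper_linear_def using zero_less_one by blast
  then obtain \<delta> where \<delta>: "\<delta> > 0"
    "\<And>t. dist t t\<^sub>0 < \<delta> \<Longrightarrow> len t \<le> len t\<^sub>0 - \<kappa> * (t - t\<^sub>0) + \<bar>t - t\<^sub>0\<bar>"
    unfolding eventually_nhds_metric by auto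
  have far: "\<exists>t. t \<noteq> t\<^sub>0 \<and> dist t t\<^sub>0 < d \<and> \<epsilon> \<le> dist ((len t - len t\<^sub>0) / (t - t\<^sub>0)) (- \<kappa>)" if "d > 0" for d
    using not that unfolding eventually_at by (metis UNIV_I not_less)
  have "\<exists>t. t \<noteq> t\<^sub>0 \<and> dist t t\<^sub>0 < min \<delta> (1 / Suc n) \<and>
      \<epsilon> \<le> dist ((len t - len t\<^sub>0) / (t - t\<^sub>0)) (- \<kappa>)" for n
    by (rule far) (use \<delta>(1) in simp)
  then obtain X where X: "\<And>n. X n \<noteq> t\<^sub>0" "\<And>n. dist (X n) t\<^sub>0 < min \<delta> (1 / Suc n)"
    "\<And>n. \<epsilon> \<le> dist ((len (X n) - len t\<^sub>0) / (X n - t\<^sub>0)) (- \<kappa>)"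
    by metis
  have X_lim: "X \<longlonglongrightarrow> t\<^sub>0"
  proof (rule metric_tendsto_imp_tendsto[OF LIMSEQ_inverse_real_of_nat])
    show "\<forall>\<^sub>F n in sequentially. dist (X n) t\<^sub>0 \<le> dist (inverse (real (Suc n))) 0"
      using X(2) by (intro always_eventually allI) (auto simp: inverse_eq_divide intro: less_imp_le)
  qed
  define u where "u n = len t\<^sub>0 - \<kappa> * (X n - t\<^sub>0) + \<bar>X n - t\<^sub>0\<bar>" for n
  have u: "len (X n) \<le> u n" for n using \<delta>(2)[of "X n"] X(2)[of n] by (simp add: u_def)
  have u_lim: "u \<longlonglongrightarrow> len t\<^sub>0"
    unfolding u_def[abs_def] by (rule tendsto_eq_intros X_lim refl | simp)+
  have "\<forall>n. \<exists>\<psi> m::int. csc_param v (X n) (\<beta> + 2 * pi * m) \<psi> \<and>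
      len (X n) = csc_length v (X n) (\<beta> + 2 * pi * m) \<psi>"
    using attained by blast
  then obtain \<psi> and m :: "nat \<Rightarrow> int" where "\<forall>n. csc_param v (X n) (\<beta> + 2 * pi * (m n)) (\<psi> n) \<and>
      len (X n) = csc_length v (X n) (\<beta> + 2 * pi * (m n)) (\<psi> n)"
    unfolding choice_iff by blast
  then have p: "\<And>n. csc_param v (X n) (\<beta> + 2 * pi * of_int (m n)) (\<psi> n)"
    "\<And>n. len (X n) = csc_length v (X n) (\<beta> + 2 * pi * of_int (m n)) (\<psi> n)"
    by auto
  define B where "B n = \<beta> + 2 * pi * of_int (m n)" for n
  note p = p[folded B_def]
  \<comment> \<open>Neither arc is longer than the whole curve, which bounds the directions and the
    lifted final headings.\<close>
  have arcs: "\<bar>\<psi> n - X n\<bar> \<le> u n" "\<bar>B n - \<psi> n\<bar> \<le> u n" for n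
    using u[of n] p(1)[of n] unfolding p(2) csc_length_alt csc_param_def by linarith+
  from convergent_imp_Bseq[OF convergentI[OF u_lim]] convergent_imp_Bseq[OF convergentI[OF X_lim]]
  obtain M M' where M: "\<And>n. \<bar>u n\<bar> \<le> M" "\<And>n. \<bar>X n\<bar> \<le> M'"
    by (auto simp: Bseq_def)
  have "bounded (range (\<lambda>n. (\<psi> n, B n)))"
  proof (rule boundedI)
    fix z assume "z \<in> range (\<lambda>n. (\<psi> n, B n))"
    then obtain n where z: "z = (\<psi> n, B n)" by blast
    have "norm z \<le> \<bar>\<psi> n\<bar> + \<bar>B n\<bar>" using norm_Pair_le[of "\<psi> n" "B n"] z by simp
    also have "\<dots> \<le> 3 * M + 2 * M'" using arcs[of n] M(1)[of n] M(2)[of n] by linarith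
    finally show "norm z \<le> 3 * M + 2 * M'" .
  qed
  from bounded_imp_convergent_subsequence[OF this] obtain l r where r: "strict_mono (r :: nat \<Rightarrow> nat)"
    and "((\<lambda>n. (\<psi> n, B n)) \<circ> r) \<longlonglongrightarrow> l" by blast
  then have \<psi>_lim: "(\<lambda>n. \<psi> (r n)) \<longlonglongrightarrow> fst l" and B_lim: "(\<lambda>n. B (r n)) \<longlonglongrightarrow> snd l"
    using tendsto_fst[of "(\<lambda>n. (\<psi> n, B n)) \<circ> r" l] tendsto_snd[of "(\<lambda>n. (\<psi> n, B n)) \<circ> r" l]
    by (auto simp: o_def)
  define \<psi>' where "\<psi>' = fst l"
  have Xr_lim: "(\<lambda>n. X (r n)) \<longlonglongrightarrow> t\<^sub>0" and ur_lim: "(\<lambda>n. u (r n)) \<longlonglongrightarrow> len t\<^sub>0"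
    using LIMSEQ_subseq_LIMSEQ[OF X_lim r] LIMSEQ_subseq_LIMSEQ[OF u_lim r] by (simp_all add: o_def)
  \<comment> \<open>The lifted final headings differ by multiples of a full turn, so convergence
    makes them eventually constant.\<close>
  from B_lim obtain N where N: "\<And>n. n \<ge> N \<Longrightarrow> \<bar>B (r n) - snd l\<bar> < pi"
    unfolding LIMSEQ_def dist_real_def using pi_gt_zero by blast
  define m' where "m' = m (r N)"
  have m': "m (r n) = m'" if "n \<ge> N" for n
  proof -
    have "\<bar>B (r n) - B (r N)\<bar> < 2 * pi" using N[OF that] N[of N] by simp
    moreover have "B (r n) - B (r N) = 2 * pi * of_int (m (r n) - m')"
      by (simp add: B_def m'_def algebra_simps)
    ultimately have "\<bar>of_int (m (r n) - m') :: real\<bar> < 1"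
      by (simp add: abs_mult)
    then show ?thesis by linarith
  qed
  define B' where "B' = \<beta> + 2 * pi * of_int m'"
  have B': "B (r n) = B'" if "n \<ge> N" for n using m'[OF that] by (simp add: B_def B'_def)
  have ev: "\<forall>\<^sub>F n in sequentially. B (r n) = B'"
    using B' eventually_sequentially by blast
  note lims = \<psi>_lim[folded \<psi>'_def] Xr_lim
  have "csc_slope v t\<^sub>0 B' \<psi>' = 0"
  proof (rule LIMSEQ_unique[OF _ tendsto_eventually])
    show "(\<lambda>n. csc_slope v (X (r n)) B' (\<psi> (r n))) \<longlonglongrightarrow> csc_slope v t\<^sub>0 B' \<psi>'"
      unfolding csc_slope_def by (intro tendsto_intros lims)
    show "\<forall>\<^sub>F n in sequentially. csc_slope v (X (r n)) B' (\<psi> (r n)) = 0"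
      using ev by eventually_elim (use p(1) in \<open>auto simp: csc_param_def\<close>)
  qed
  moreover have "0 \<le> csc_segment v t\<^sub>0 B' \<psi>'"
  proof (rule tendsto_lowerbound)
    show "(\<lambda>n. csc_segment v (X (r n)) B' (\<psi> (r n))) \<longlonglongrightarrow> csc_segment v t\<^sub>0 B' \<psi>'"
      unfolding csc_segment_def by (intro tendsto_intros lims)
    show "\<forall>\<^sub>F n in sequentially. 0 \<le> csc_segment v (X (r n)) B' (\<psi> (r n))"
      using ev by eventually_elim (use p(1) in \<open>auto simp: csc_param_def\<close>)
  qed simp
  ultimately have p': "csc_param v t\<^sub>0 B' \<psi>'" by (simp add: csc_param_def)
  \<comment> \<open>Passing to the limit shows that the limit curve is not longer than
    \<open>len t\<^sub>0\<close>; by minimality it attains it.\<close>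
  have "csc_length v t\<^sub>0 B' \<psi>' \<le> len t\<^sub>0"
  proof (rule tendsto_le[OF _ ur_lim])
    show "(\<lambda>n. csc_length v (X (r n)) B' (\<psi> (r n))) \<longlonglongrightarrow> csc_length v t\<^sub>0 B' \<psi>'"
      unfolding csc_length_def by (intro tendsto_intros lims)
    show "\<forall>\<^sub>F n in sequentially. csc_length v (X (r n)) B' (\<psi> (r n)) \<le> u (r n)"
      using ev by eventually_elim (use p(2) u in metis)
  qed simp
  then have len_t0: "len t\<^sub>0 = csc_length v t\<^sub>0 B' \<psi>'"
    using le p' unfolding B'_def by (meson order_antisym)
  then have \<kappa>: "turn_lever (\<psi>' - t\<^sub>0) = \<kappa>" using unique p' unfolding B'_def by blast
  \<comment> \<open>The variation is taken around the limit \<open>\<psi>'\<close>, which may differ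
    from \<open>\<psi>\<^sub>0\<close>; only the lever is known to agree.\<close>
  obtain d where d: "d > 0" "\<And>t \<psi>. \<bar>\<psi> - \<psi>'\<bar> < d \<Longrightarrow> csc_param v t B' \<psi> \<Longrightarrow>
    \<bar>csc_length v t B' \<psi> - csc_length v t\<^sub>0 B' \<psi>' + \<kappa> * (t - t\<^sub>0)\<bar>
      \<le> \<bar>t - t\<^sub>0\<bar> * (\<bar>t - t\<^sub>0\<bar> + 2 * \<bar>\<psi> - \<psi>'\<bar>)"
    using csc_length_first_variation[OF v p'] unfolding \<kappa> by blast
  have "(\<lambda>n. \<bar>X (r n) - t\<^sub>0\<bar> + 2 * \<bar>\<psi> (r n) - \<psi>'\<bar>) \<longlonglongrightarrow> \<bar>t\<^sub>0 - t\<^sub>0\<bar> + 2 * \<bar>\<psi>' - \<psi>'\<bar>"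
    by (intro tendsto_intros lims)
  then have "\<forall>\<^sub>F n in sequentially. \<bar>X (r n) - t\<^sub>0\<bar> + 2 * \<bar>\<psi> (r n) - \<psi>'\<bar> < min \<epsilon> d"
    using \<epsilon> d(1) by (intro order_tendstoD(2)) auto
  with ev have "\<forall>\<^sub>F n in sequentially. False"
  proof eventually_elim
    fix n assume B: "B (r n) = B'" and small: "\<bar>X (r n) - t\<^sub>0\<bar> + 2 * \<bar>\<psi> (r n) - \<psi>'\<bar> < min \<epsilon> d"
    have "\<bar>X (r n) - t\<^sub>0\<bar> + 2 * \<bar>\<psi> (r n) - \<psi>'\<bar> < d" using small by simp
    moreover have "b < d" if "a + 2 * b < d" "0 \<le> a" "0 \<le> b" for a b :: real
      using that by linarith
    ultimately have "\<bar>\<psi> (r n) - \<psi>'\<bar> < d" using abs_ge_zero by blast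
    then have "\<bar>len (X (r n)) - len t\<^sub>0 + \<kappa> * (X (r n) - t\<^sub>0)\<bar>
      \<le> \<bar>X (r n) - t\<^sub>0\<bar> * (\<bar>X (r n) - t\<^sub>0\<bar> + 2 * \<bar>\<psi> (r n) - \<psi>'\<bar>)"
      using d(2) p[of "r n"] len_t0 unfolding B by metis
    also have "\<dots> < \<bar>X (r n) - t\<^sub>0\<bar> * \<epsilon>"
      using small X(1)[of "r n"] by (intro mult_strict_left_mono) auto
    finally have "\<bar>len (X (r n)) - len t\<^sub>0 + \<kappa> * (X (r n) - t\<^sub>0)\<bar> < \<bar>X (r n) - t\<^sub>0\<bar> * \<epsilon>" .
    moreover have "(len (X (r n)) - len t\<^sub>0) / (X (r n) - t\<^sub>0) + \<kappa>
      = (len (X (r n)) - len t\<^sub>0 + \<kappa> * (X (r n) - t\<^sub>0)) / (X (r n) - t\<^sub>0)"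
      using X(1)[of "r n"] by (simp add: field_simps)
    ultimately have "\<bar>(len (X (r n)) - len t\<^sub>0) / (X (r n) - t\<^sub>0) + \<kappa>\<bar> < \<epsilon>"
      using X(1)[of "r n"] by (simp add: abs_divide pos_divide_less_eq mult.commute)
    then show False using X(3)[of "r n"] by (simp add: dist_real_def)
  qed
  then show False by simp
qed

section \<open>Curves of type CSC\<close>

lemma heading_nth [simp]: "heading \<phi> $ 1 = cos \<phi>" "heading \<phi> $ 2 = sin \<phi>"
  by (simp_all add: heading_def)

lemma vec2_eq_iff: "a = b \<longleftrightarrow> a $ 1 = b $ 1 \<and> a $ 2 = b $ 2" for a b :: "real^2"
  by (simp add: vec_eq_iff forall_2)

lemma norm_vec2: "norm a = sqrt ((a $ 1)\<^sup>2 + (a $ 2)\<^sup>2)" for a :: "real^2"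
  by (simp add: norm_vec_def L2_set_def sum_2)

lemma norm_heading [simp]: "norm (heading \<phi>) = 1"
  by (simp add: norm_vec2)

lemma heading_eq_iff: "heading \<alpha> = heading \<beta> \<longleftrightarrow> (\<exists>m::int. \<alpha> = \<beta> + 2 * pi * m)"
  unfolding vec2_eq_iff heading_nth using sin_cos_eq_iff[of \<alpha> \<beta>] by blast

lemma heading_eq_imp_eq:
  assumes "heading \<alpha> = heading \<beta>" "\<bar>\<alpha> - \<beta>\<bar> < 2 * pi"
  shows "\<alpha> = \<beta>"
proof -
  obtain m :: int where m: "\<alpha> = \<beta> + 2 * pi * m" using assms(1) heading_eq_iff by blast
  then have "\<bar>of_int m :: real\<bar> < 1" using assms(2) by (simp add: abs_mult)
  then have "m = 0" by linarith
  then show ?thesis using m by simp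
qed

text \<open>A chord of the unit circle is twice the sine of half its angle. A Lipschitz bound on the
  tangent angle thus becomes the curvature bound.\<close>

lemma dist_heading_le: "dist (heading x) (heading y) \<le> \<bar>x - y\<bar>"
proof -
  have "dist (heading x) (heading y) = sqrt ((cos x - cos y)\<^sup>2 + (sin x - sin y)\<^sup>2)"
    by (simp add: dist_norm norm_vec2)
  also have "(cos x - cos y)\<^sup>2 + (sin x - sin y)\<^sup>2 = 2 - 2 * cos (x - y)"
    using sin_cos_squared_add[of x] sin_cos_squared_add[of y]
    by (simp add: cos_diff power2_eq_square algebra_simps)
  also have "\<dots> = (2 * sin ((x - y) / 2))\<^sup>2"
    using cos_double_sin[of "(x - y) / 2"]
    by (simp only: times_divide_eq_right nonzero_mult_div_cancel_left power_mult_distrib) simp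
  also have "sqrt \<dots> \<le> \<bar>x - y\<bar>"
    unfolding real_sqrt_abs using abs_sin_x_le_abs_x[of "(x - y) / 2"] by (simp add: abs_mult)
  finally show ?thesis .
qed

lemma heading_add_cong: "heading x = heading y \<Longrightarrow> heading (x + z) = heading (y + z)"
  by (simp add: vec2_eq_iff cos_add sin_add)

lemma heading_quarter_turn: "\<sigma> \<in> {-1, 1} \<Longrightarrow> \<sigma> *\<^sub>R heading (x + pi / 2) = heading (x + \<sigma> * pi / 2)"
  by (auto simp: vec2_eq_iff cos_add sin_add)

lemma has_vector_derivative_heading:
  assumes "(g has_real_derivative g') (at t within S)"
  shows "((\<lambda>t. heading (g t)) has_vector_derivative g' *\<^sub>R heading (g t + pi / 2)) (at t within S)"
proof -
  have alt: "heading x = cos x *\<^sub>R axis 1 1 + sin x *\<^sub>R axis 2 1" for x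
    by (simp add: vec2_eq_iff axis_def)
  have "((\<lambda>t. cos (g t) *\<^sub>R axis 1 1 + sin (g t) *\<^sub>R axis 2 1 :: real^2) has_vector_derivative
     (- sin (g t) * g') *\<^sub>R axis 1 1 + (cos (g t) * g') *\<^sub>R axis 2 1) (at t within S)"
    by (auto intro!: derivative_eq_intros assms)
  then show ?thesis
    unfolding alt by (simp add: cos_add sin_add scaleR_diff_right mult.commute)
qed

section \<open>Displacements along arcs, segments and whole CSC curves\<close>

lemma displacement_eq:
  fixes \<gamma> \<gamma>' :: "real \<Rightarrow> real^2"
  assumes "a \<le> b"
    and "\<And>t. t \<in> {a..b} \<Longrightarrow> (\<gamma> has_vector_derivative v t) (at t within {a..b})"
    and "\<And>t. t \<in> {a..b} \<Longrightarrow> (\<gamma>' has_vector_derivative v t) (at t within {a..b})"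
  shows "\<gamma> b - \<gamma> a = \<gamma>' b - \<gamma>' a"
  using fundamental_theorem_of_calculus[OF assms(1,2)] fundamental_theorem_of_calculus[OF assms(1,3)]
  by (rule has_integral_unique)

lemma arc_displacement:
  fixes \<sigma> :: real
  assumes "a \<le> b" and "\<sigma> \<in> {-1, 1}"
    and "\<And>t. t \<in> {a..b} \<Longrightarrow> (\<gamma> has_vector_derivative heading (\<eta> + \<sigma> * (t - a))) (at t within {a..b})"
  shows "\<gamma> b - \<gamma> a = \<sigma> *\<^sub>R (heading (\<eta> + \<sigma> * (b - a) - pi / 2) - heading (\<eta> - pi / 2))"
proof -
  \<comment> \<open>The comparison curve runs on a unit circle. In a left turn the radius vector is
    a quarter turn behind the tangent; the factor \<open>\<sigma>\<close> reverses it in a right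
    turn.\<close>
  have "((\<lambda>t. \<sigma> *\<^sub>R heading (\<eta> + \<sigma> * (t - a) - pi / 2)) has_vector_derivative
     heading (\<eta> + \<sigma> * (t - a))) (at t within {a..b})" for t
  proof -
    have "((\<lambda>t. heading (\<eta> + \<sigma> * (t - a) - pi / 2)) has_vector_derivative
      \<sigma> *\<^sub>R heading (\<eta> + \<sigma> * (t - a) - pi / 2 + pi / 2)) (at t within {a..b})"
      by (rule has_vector_derivative_heading) (auto intro!: derivative_eq_intros)
    from has_vector_derivative_scaleR[OF DERIV_const this, of \<sigma>] show ?thesis
      using assms(2) by auto
  qed
  from displacement_eq[OF assms(1,3) this] show ?thesis
    by (simp add: scaleR_diff_right)
qed

lemma segment_displacement:
  assumes "a \<le> b"
    and "\<And>t. t \<in> {a..b} \<Longrightarrow> (\<gamma> has_vector_derivative u) (at t within {a..b})"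
  shows "\<gamma> b - \<gamma> a = (b - a) *\<^sub>R (u :: real^2)"
proof -
  have "((\<lambda>t. (t - a) *\<^sub>R u) has_vector_derivative u) (at t within {a..b})" for t
    by (auto intro!: derivative_eq_intros)
  from displacement_eq[OF assms this] show ?thesis by simp
qed

text \<open>The tangent angle at arc length \<open>t\<close>, with \<open>s\<close> the length of
  the segment. \<open>min\<close> stops the first turn at \<open>\<psi>\<close>, \<open>max\<close>
  delays the second until the segment has ended, and \<open>sgn 0 = 0\<close> covers empty
  arcs.\<close>

definition csc_angle :: "real \<Rightarrow> real \<Rightarrow> real \<Rightarrow> real \<Rightarrow> real \<Rightarrow> real" where
  "csc_angle \<alpha> \<beta> \<psi> s t =
     \<alpha> + sgn (\<psi> - \<alpha>) * min t \<bar>\<psi> - \<alpha>\<bar> + sgn (\<beta> - \<psi>) * max 0 (t - \<bar>\<psi> - \<alpha>\<bar> - s)"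

lemma csc_angle_first_arc:
  "0 \<le> s \<Longrightarrow> t \<le> \<bar>\<psi> - \<alpha>\<bar> \<Longrightarrow> csc_angle \<alpha> \<beta> \<psi> s t = \<alpha> + sgn (\<psi> - \<alpha>) * t"
  by (simp add: csc_angle_def)

lemma csc_angle_segment:
  "\<bar>\<psi> - \<alpha>\<bar> \<le> t \<Longrightarrow> t \<le> \<bar>\<psi> - \<alpha>\<bar> + s \<Longrightarrow> csc_angle \<alpha> \<beta> \<psi> s t = \<psi>"
  by (simp add: csc_angle_def sgn_mult_abs)

lemma csc_angle_last_arc:
  "0 \<le> s \<Longrightarrow> \<bar>\<psi> - \<alpha>\<bar> + s \<le> t \<Longrightarrow>
    csc_angle \<alpha> \<beta> \<psi> s t = \<psi> + sgn (\<beta> - \<psi>) * (t - (\<bar>\<psi> - \<alpha>\<bar> + s))"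
  by (simp add: csc_angle_def sgn_mult_abs diff_diff_eq)

lemma csc_angle_lipschitz:
  assumes "0 \<le> s"
  shows "\<bar>csc_angle \<alpha> \<beta> \<psi> s t - csc_angle \<alpha> \<beta> \<psi> s t'\<bar> \<le> \<bar>t - t'\<bar>"
proof -
  define a where "a = \<bar>\<psi> - \<alpha>\<bar>"
  have "\<bar>sgn (\<psi> - \<alpha>) * (min t a - min t' a) + sgn (\<beta> - \<psi>) * (max 0 (t - a - s) - max 0 (t' - a - s))\<bar>
    \<le> \<bar>sgn (\<psi> - \<alpha>) * (min t a - min t' a)\<bar> + \<bar>sgn (\<beta> - \<psi>) * (max 0 (t - a - s) - max 0 (t' - a - s))\<bar>"
    by (rule abs_triangle_ineq)
  also have "\<dots> \<le> \<bar>min t a - min t' a\<bar> + \<bar>max 0 (t - a - s) - max 0 (t' - a - s)\<bar>"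
    by (intro add_mono) (auto simp: abs_mult abs_sgn_eq)
  \<comment> \<open>As \<open>0 \<le> s\<close>, the first term varies only before the segment and
    the second only after it, so their changes do not overlap.\<close>
  also have "\<dots> \<le> \<bar>t - t'\<bar>" using assms by (simp add: min_def max_def)
  finally show ?thesis by (simp add: csc_angle_def a_def algebra_simps)
qed

lemma csc_displacements:
  fixes \<gamma> :: "real \<Rightarrow> real^2" and \<alpha> \<beta> \<psi> s l :: real
  defines "a \<equiv> \<bar>\<psi> - \<alpha>\<bar>"
  assumes s: "0 \<le> s" and l: "l = \<bar>\<psi> - \<alpha>\<bar> + s + \<bar>\<beta> - \<psi>\<bar>"
    and d: "\<And>t. t \<in> {0..l} \<Longrightarrow>
      (\<gamma> has_vector_derivative heading (csc_angle \<alpha> \<beta> \<psi> s t)) (at t within {0..l})"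
  shows "\<gamma> a - \<gamma> 0 = sgn (\<psi> - \<alpha>) *\<^sub>R (heading (\<psi> - pi / 2) - heading (\<alpha> - pi / 2))"
    and "\<gamma> (a + s) - \<gamma> a = s *\<^sub>R heading \<psi>"
    and "\<gamma> l - \<gamma> (a + s) = sgn (\<beta> - \<psi>) *\<^sub>R (heading (\<beta> - pi / 2) - heading (\<psi> - pi / 2))"
proof -
  have d': "(\<gamma> has_vector_derivative heading (csc_angle \<alpha> \<beta> \<psi> s t)) (at t within {b..c})"
    if "t \<in> {b..c}" "0 \<le> b" "c \<le> l" for b c t
    using d[of t] that by (auto intro: has_vector_derivative_within_subset)
  have sgn_cases: "sgn x \<in> {-1, 1}" if "x \<noteq> 0" for x :: real
    using that by (auto simp: sgn_if)
  have a: "0 \<le> a" by (simp add: a_def)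
  show "\<gamma> a - \<gamma> 0 = sgn (\<psi> - \<alpha>) *\<^sub>R (heading (\<psi> - pi / 2) - heading (\<alpha> - pi / 2))"
  \<comment> \<open>For an arc of length zero the sign is 0, so \<open>arc_displacement\<close> does
    not apply, but both sides vanish.\<close>
  proof (cases "\<psi> = \<alpha>")
    case True then show ?thesis by (simp add: a_def)
  next
    case False
    have "\<gamma> a - \<gamma> 0 = sgn (\<psi> - \<alpha>) *\<^sub>R
      (heading (\<alpha> + sgn (\<psi> - \<alpha>) * (a - 0) - pi / 2) - heading (\<alpha> - pi / 2))"
    proof (rule arc_displacement[OF a])
      fix t assume t: "t \<in> {0..a}"
      show "(\<gamma> has_vector_derivative heading (\<alpha> + sgn (\<psi> - \<alpha>) * (t - 0))) (at t within {0..a})"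
        using d'[OF t] t s l csc_angle_first_arc[OF s, of t \<psi> \<alpha> \<beta>] by (simp add: a_def)
    qed (use False sgn_cases in auto)
    then show ?thesis by (simp add: a_def sgn_mult_abs)
  qed
  have "\<gamma> (a + s) - \<gamma> a = (a + s - a) *\<^sub>R heading \<psi>"
  proof (rule segment_displacement)
    fix t assume t: "t \<in> {a..a + s}"
    show "(\<gamma> has_vector_derivative heading \<psi>) (at t within {a..a + s})"
      using d'[OF t] t s l csc_angle_segment[of \<psi> \<alpha> t s \<beta>] by (simp add: a_def)
  qed (use s in auto)
  then show "\<gamma> (a + s) - \<gamma> a = s *\<^sub>R heading \<psi>" by simp
  have le: "a + s \<le> l" using l by (simp add: a_def)
  show "\<gamma> l - \<gamma> (a + s) = sgn (\<beta> - \<psi>) *\<^sub>R (heading (\<beta> - pi / 2) - heading (\<psi> - pi / 2))"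
  proof (cases "\<beta> = \<psi>")
    case True then show ?thesis using l by (simp add: a_def)
  next
    case False
    have "\<gamma> l - \<gamma> (a + s) = sgn (\<beta> - \<psi>) *\<^sub>R
      (heading (\<psi> + sgn (\<beta> - \<psi>) * (l - (a + s)) - pi / 2) - heading (\<psi> - pi / 2))"
    proof (rule arc_displacement[OF le])
      fix t assume t: "t \<in> {a + s..l}"
      show "(\<gamma> has_vector_derivative heading (\<psi> + sgn (\<beta> - \<psi>) * (t - (a + s)))) (at t within {a + s..l})"
        using d'[OF t] t s a csc_angle_last_arc[OF s, of \<psi> \<alpha> t \<beta>] by (simp add: a_def)
    qed (use False sgn_cases in auto)
    moreover have "sgn (\<beta> - \<psi>) * (l - (a + s)) = \<beta> - \<psi>"
      using l by (simp add: a_def sgn_mult_abs)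
    ultimately show ?thesis by simp
  qed
qed

text \<open>\<open>d\<close> is the displacement along the arc turning from \<open>\<alpha>\<close>
  to \<open>\<psi>\<close>. It is resolved in the frames of both end tangents because the segment
  follows the first arc but precedes the last one.\<close>

lemma turn_components:
  fixes \<alpha> \<psi> :: real
  defines "d \<equiv> sgn (\<psi> - \<alpha>) *\<^sub>R (heading (\<psi> - pi / 2) - heading (\<alpha> - pi / 2))"
  shows "d $ 1 * cos \<psi> + d $ 2 * sin \<psi> = sin \<bar>\<psi> - \<alpha>\<bar>"
    and "d $ 1 * sin \<psi> - d $ 2 * cos \<psi> = turn_lever (\<psi> - \<alpha>)"
    and "d $ 1 * cos \<alpha> + d $ 2 * sin \<alpha> = sin \<bar>\<psi> - \<alpha>\<bar>"
    and "d $ 1 * sin \<alpha> - d $ 2 * cos \<alpha> = - turn_lever (\<psi> - \<alpha>)"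
proof -
  have abs: "sin \<bar>\<psi> - \<alpha>\<bar> = sgn (\<psi> - \<alpha>) * sin (\<psi> - \<alpha>)"
    by (auto simp: sgn_if abs_if sin_diff)
  have comp: "d $ 1 = sgn (\<psi> - \<alpha>) * (sin \<psi> - sin \<alpha>)" "d $ 2 = sgn (\<psi> - \<alpha>) * (cos \<alpha> - cos \<psi>)"
    by (simp_all add: d_def cos_diff sin_diff)
  have e: "cos \<psi> * cos \<psi> + sin \<psi> * sin \<psi> = 1" "cos \<alpha> * cos \<alpha> + sin \<alpha> * sin \<alpha> = 1"
    using sin_cos_squared_add2 by (simp_all add: power2_eq_square)
  show "d $ 1 * cos \<psi> + d $ 2 * sin \<psi> = sin \<bar>\<psi> - \<alpha>\<bar>"
    "d $ 1 * cos \<alpha> + d $ 2 * sin \<alpha> = sin \<bar>\<psi> - \<alpha>\<bar>"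
    unfolding abs comp by (simp_all add: sin_diff algebra_simps)
  have "d $ 1 * sin \<psi> - d $ 2 * cos \<psi>
    = sgn (\<psi> - \<alpha>) * (cos \<psi> * cos \<psi> + sin \<psi> * sin \<psi> - (cos \<psi> * cos \<alpha> + sin \<psi> * sin \<alpha>))"
    unfolding comp by (simp add: algebra_simps del: sin_cos_squared_add3)
  then show "d $ 1 * sin \<psi> - d $ 2 * cos \<psi> = turn_lever (\<psi> - \<alpha>)"
    unfolding e by (simp add: turn_lever_def cos_diff)
  have "d $ 1 * sin \<alpha> - d $ 2 * cos \<alpha>
    = - (sgn (\<psi> - \<alpha>) * (cos \<alpha> * cos \<alpha> + sin \<alpha> * sin \<alpha> - (cos \<psi> * cos \<alpha> + sin \<psi> * sin \<alpha>)))"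
    unfolding comp by (simp add: algebra_simps del: sin_cos_squared_add3)
  then show "d $ 1 * sin \<alpha> - d $ 2 * cos \<alpha> = - turn_lever (\<psi> - \<alpha>)"
    unfolding e by (simp add: turn_lever_def cos_diff)
qed

text \<open>The three displacements are added in the frame of the segment. The component along it
  yields the formula for the segment length, the component across it the vanishing of the
  slope.\<close>

lemma csc_endpoint:
  fixes \<gamma> :: "real \<Rightarrow> real^2" and \<alpha> \<beta> \<psi> s l :: real
  assumes s: "0 \<le> s" and l: "l = \<bar>\<psi> - \<alpha>\<bar> + s + \<bar>\<beta> - \<psi>\<bar>"
    and d: "\<And>t. t \<in> {0..l} \<Longrightarrow>
      (\<gamma> has_vector_derivative heading (csc_angle \<alpha> \<beta> \<psi> s t)) (at t within {0..l})"
  defines "w \<equiv> \<gamma> l - \<gamma> 0"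
  shows "w $ 1 * cos \<psi> + w $ 2 * sin \<psi> = sin \<bar>\<psi> - \<alpha>\<bar> + s + sin \<bar>\<beta> - \<psi>\<bar>"
    and "w $ 1 * sin \<psi> - w $ 2 * cos \<psi> = turn_lever (\<psi> - \<alpha>) - turn_lever (\<beta> - \<psi>)"
proof -
  define a where "a = \<bar>\<psi> - \<alpha>\<bar>"
  have w: "w = (\<gamma> a - \<gamma> 0) + (\<gamma> (a + s) - \<gamma> a) + (\<gamma> l - \<gamma> (a + s))"
    by (simp add: w_def)
  have D: "\<gamma> a - \<gamma> 0 = sgn (\<psi> - \<alpha>) *\<^sub>R (heading (\<psi> - pi / 2) - heading (\<alpha> - pi / 2))"
    "\<gamma> (a + s) - \<gamma> a = s *\<^sub>R heading \<psi>"
    "\<gamma> l - \<gamma> (a + s) = sgn (\<beta> - \<psi>) *\<^sub>R (heading (\<beta> - pi / 2) - heading (\<psi> - pi / 2))"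
    unfolding a_def by (rule csc_displacements[OF s l d]; assumption)+
  have seg: "(s *\<^sub>R heading \<psi>) $ 1 * cos \<psi> + (s *\<^sub>R heading \<psi>) $ 2 * sin \<psi> = s"
    "(s *\<^sub>R heading \<psi>) $ 1 * sin \<psi> - (s *\<^sub>R heading \<psi>) $ 2 * cos \<psi> = 0"
    using sin_cos_squared_add2[of \<psi>] by (simp_all add: power2_eq_square mult.assoc flip: distrib_left)
  have lin: "(x + y + z) $ 1 * cos \<psi> + (x + y + z) $ 2 * sin \<psi> =
      (x $ 1 * cos \<psi> + x $ 2 * sin \<psi>) + (y $ 1 * cos \<psi> + y $ 2 * sin \<psi>) + (z $ 1 * cos \<psi> + z $ 2 * sin \<psi>)"
    "(x + y + z) $ 1 * sin \<psi> - (x + y + z) $ 2 * cos \<psi> =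
      (x $ 1 * sin \<psi> - x $ 2 * cos \<psi>) + (y $ 1 * sin \<psi> - y $ 2 * cos \<psi>) + (z $ 1 * sin \<psi> - z $ 2 * cos \<psi>)"
    for x y z :: "real^2"
    by (simp_all add: algebra_simps)
  show "w $ 1 * cos \<psi> + w $ 2 * sin \<psi> = sin \<bar>\<psi> - \<alpha>\<bar> + s + sin \<bar>\<beta> - \<psi>\<bar>"
    unfolding w lin D turn_components seg ..
  show "w $ 1 * sin \<psi> - w $ 2 * cos \<psi> = turn_lever (\<psi> - \<alpha>) - turn_lever (\<beta> - \<psi>)"
    unfolding w lin D turn_components seg by simp
qed

text \<open>Provides the competitors of a Dubins curve: integrating the unit vector with the
  prescribed tangent angle gives an admissible curve, and criticality makes it end at the right
  point.\<close>

lemma csc_curve_exists: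
  assumes p: "csc_param v \<alpha> \<beta> \<psi>"
  obtains \<gamma> where "curvature_bounded_curve p \<alpha> (p + v) \<beta> (csc_length v \<alpha> \<beta> \<psi>) \<gamma>"
    "\<And>t. t \<in> {0..csc_length v \<alpha> \<beta> \<psi>} \<Longrightarrow>
      (\<gamma> has_vector_derivative heading (csc_angle \<alpha> \<beta> \<psi> (csc_segment v \<alpha> \<beta> \<psi>) t))
        (at t within {0..csc_length v \<alpha> \<beta> \<psi>})"
proof -
  define s where "s = csc_segment v \<alpha> \<beta> \<psi>"
  define l where "l = csc_length v \<alpha> \<beta> \<psi>"
  define u where "u t = heading (csc_angle \<alpha> \<beta> \<psi> s t)" for t
  define \<gamma> where "\<gamma> t = p + integral {0..t} u" for t
  have s: "0 \<le> s" and slope: "csc_slope v \<alpha> \<beta> \<psi> = 0" using p by (simp_all add: csc_param_def s_def)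
  have l: "l = \<bar>\<psi> - \<alpha>\<bar> + s + \<bar>\<beta> - \<psi>\<bar>" by (simp add: l_def s_def csc_length_alt)
  then have "0 \<le> l" using s by simp
  have lip: "1-lipschitz_on A u" for A
  proof (rule lipschitz_onI)
    fix x y show "dist (u x) (u y) \<le> 1 * dist x y"
      using dist_heading_le csc_angle_lipschitz[OF s, of \<alpha> \<beta> \<psi> x y]
      by (simp add: u_def dist_real_def) (meson order_trans)
  qed simp
  have d: "(\<gamma> has_vector_derivative heading (csc_angle \<alpha> \<beta> \<psi> s t)) (at t within {0..l})"
    if "t \<in> {0..l}" for t
    using integral_has_vector_derivative[OF lipschitz_on_continuous_on[OF lip] that]
    unfolding \<gamma>_def u_def[symmetric] by (auto intro!: derivative_eq_intros)
  define w where "w = \<gamma> l - \<gamma> 0"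
  have E: "w $ 1 * cos \<psi> + w $ 2 * sin \<psi> = sin \<bar>\<psi> - \<alpha>\<bar> + s + sin \<bar>\<beta> - \<psi>\<bar>"
    "w $ 1 * sin \<psi> - w $ 2 * cos \<psi> = turn_lever (\<psi> - \<alpha>) - turn_lever (\<beta> - \<psi>)"
    unfolding w_def by (rule csc_endpoint[OF s l d]; assumption)+
  have "w $ 1 * cos \<psi> + w $ 2 * sin \<psi> = v $ 1 * cos \<psi> + v $ 2 * sin \<psi>"
    unfolding E by (simp add: s_def csc_segment_def abs_minus_commute)
  moreover have "turn_lever (\<beta> - \<psi>) = - turn_lever (\<psi> - \<beta>)"
    using turn_lever_minus[of "\<psi> - \<beta>"] by simp
  then have "w $ 1 * sin \<psi> - w $ 2 * cos \<psi> = v $ 1 * sin \<psi> - v $ 2 * cos \<psi>"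
    unfolding E using slope by (simp add: csc_slope_def)
  ultimately have "(w $ 1 - v $ 1) * cos \<psi> + (w $ 2 - v $ 2) * sin \<psi> = 0"
    "(w $ 1 - v $ 1) * sin \<psi> - (w $ 2 - v $ 2) * cos \<psi> = 0"
    by (simp_all add: algebra_simps)
  then have "((w $ 1 - v $ 1)\<^sup>2 + (w $ 2 - v $ 2)\<^sup>2) * ((cos \<psi>)\<^sup>2 + (sin \<psi>)\<^sup>2) = 0"
    unfolding sum_squares_rotation[symmetric] by simp
  then have "w = v" by (simp add: vec2_eq_iff sum_power2_eq_zero_iff)
  moreover have "\<gamma> 0 = p" by (simp add: \<gamma>_def)
  ultimately have "\<gamma> l = p + v" by (simp add: w_def algebra_simps)
  moreover have "csc_angle \<alpha> \<beta> \<psi> s 0 = \<alpha>" using csc_angle_first_arc[OF s, of 0] by simp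
  moreover have "csc_angle \<alpha> \<beta> \<psi> s l = \<beta>" using csc_angle_last_arc[OF s, of \<psi> \<alpha> l \<beta>] l
    by (simp add: sgn_mult_abs)
  ultimately have "curvature_bounded_curve p \<alpha> (p + v) \<beta> l \<gamma>"
    unfolding curvature_bounded_curve_def using \<open>0 \<le> l\<close> \<open>\<gamma> 0 = p\<close> d lip
    by (intro conjI exI[of _ u]) (auto simp: u_def)
  then show ?thesis using that d unfolding l_def s_def by blast
qed

text \<open>After its first arc the first curve goes straight or, in the degenerate case, turns the other way,
  so the second curve cannot go on turning.\<close>

lemma csc_curve_longer_arc:
  assumes v: "norm v \<ge> 4" and p: "csc_param v \<alpha> \<beta>\<^sub>1 \<psi>\<^sub>1"
    and eq: "\<And>t. t \<in> {0..csc_length v \<alpha> \<beta>\<^sub>1 \<psi>\<^sub>1} \<Longrightarrow>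
      heading (csc_angle \<alpha> \<beta>\<^sub>1 \<psi>\<^sub>1 (csc_segment v \<alpha> \<beta>\<^sub>1 \<psi>\<^sub>1) t) = heading (csc_angle \<alpha> \<beta>\<^sub>2 \<psi>\<^sub>2 s\<^sub>2 t)"
    and s2: "0 \<le> s\<^sub>2"
  shows "\<bar>\<psi>\<^sub>2 - \<alpha>\<bar> \<le> \<bar>\<psi>\<^sub>1 - \<alpha>\<bar>"
proof (rule ccontr)
  assume "\<not> ?thesis"
  then have less: "\<bar>\<psi>\<^sub>1 - \<alpha>\<bar> < \<bar>\<psi>\<^sub>2 - \<alpha>\<bar>" by simp
  define s\<^sub>1 where "s\<^sub>1 = csc_segment v \<alpha> \<beta>\<^sub>1 \<psi>\<^sub>1"
  define a where "a = \<bar>\<psi>\<^sub>1 - \<alpha>\<bar>"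
  define \<sigma> where "\<sigma> = sgn (\<psi>\<^sub>2 - \<alpha>)"
  have "\<psi>\<^sub>2 \<noteq> \<alpha>" using less by auto
  then have \<sigma>: "\<sigma> \<in> {-1, 1}" by (auto simp: \<sigma>_def sgn_if)
  have l: "csc_length v \<alpha> \<beta>\<^sub>1 \<psi>\<^sub>1 = a + s\<^sub>1 + \<bar>\<beta>\<^sub>1 - \<psi>\<^sub>1\<bar>"
    by (simp add: csc_length_alt s\<^sub>1_def a_def)
  have s1: "0 \<le> s\<^sub>1" and a: "0 \<le> a" and slope: "csc_slope v \<alpha> \<beta>\<^sub>1 \<psi>\<^sub>1 = 0"
    using p by (auto simp: csc_param_def s\<^sub>1_def a_def)
  have eq': "heading (csc_angle \<alpha> \<beta>\<^sub>1 \<psi>\<^sub>1 s\<^sub>1 t) = heading (\<alpha> + \<sigma> * t)"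
    if "0 \<le> t" "t \<le> \<bar>\<psi>\<^sub>2 - \<alpha>\<bar>" "t \<le> a + s\<^sub>1 + \<bar>\<beta>\<^sub>1 - \<psi>\<^sub>1\<bar>" for t
    using eq[of t] that csc_angle_first_arc[OF s2 that(2)] l by (simp add: s\<^sub>1_def \<sigma>_def)
  show False
  proof (cases "s\<^sub>1 = 0")
    case False
    \<comment> \<open>Just beyond \<open>a\<close> the first curve is on its segment while the
      second still turns. The cap \<open>a + 1\<close> keeps the angles within a full turn, so equal
      headings mean equal angles.\<close>
    define t where "t = min (a + s\<^sub>1) (min \<bar>\<psi>\<^sub>2 - \<alpha>\<bar> (a + 1))"
    have t: "a < t" "t \<le> a + s\<^sub>1" "t \<le> \<bar>\<psi>\<^sub>2 - \<alpha>\<bar>" "t \<le> a + 1"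
      using False s1 less by (auto simp: t_def a_def)
    have "csc_angle \<alpha> \<beta>\<^sub>1 \<psi>\<^sub>1 s\<^sub>1 a = \<psi>\<^sub>1" "csc_angle \<alpha> \<beta>\<^sub>1 \<psi>\<^sub>1 s\<^sub>1 t = \<psi>\<^sub>1"
      using csc_angle_segment t s1 by (auto simp: a_def)
    then have "heading (\<alpha> + \<sigma> * t) = heading (\<alpha> + \<sigma> * a)"
      using eq'[of a] eq'[of t] t s1 a less by (simp add: a_def)
    then have "\<alpha> + \<sigma> * t = \<alpha> + \<sigma> * a"
      using \<sigma> t pi_gt3 by (intro heading_eq_imp_eq) auto
    then show False using \<sigma> t by auto
  next
    case True
    obtain \<rho> :: real where \<rho>: "\<rho> \<in> {-1, 1}" "sgn (\<psi>\<^sub>1 - \<alpha>) = \<rho>" "sgn (\<psi>\<^sub>1 - \<beta>\<^sub>1) = \<rho>"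
      "cos (\<psi>\<^sub>1 - \<alpha>) = -1" "cos (\<psi>\<^sub>1 - \<beta>\<^sub>1) = -1"
      using degenerate_csc[OF v slope True[unfolded s\<^sub>1_def]] by blast
    have big: "pi \<le> a" "pi \<le> \<bar>\<beta>\<^sub>1 - \<psi>\<^sub>1\<bar>"
      using cos_eq_minus_one_imp[OF \<rho>(4)] cos_eq_minus_one_imp[OF \<rho>(5)]
      by (simp_all add: a_def abs_minus_commute)
    \<comment> \<open>At parameter 1 both curves are on their first arcs, of length at least
      \<open>pi\<close>; comparison there shows that they turn the same way.\<close>
    have "csc_angle \<alpha> \<beta>\<^sub>1 \<psi>\<^sub>1 s\<^sub>1 1 = \<alpha> + \<rho>"
      using csc_angle_first_arc[OF s1, of 1 \<psi>\<^sub>1 \<alpha> \<beta>\<^sub>1] big pi_gt3 \<rho>(2) by (simp add: a_def)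
    then have "heading (\<alpha> + \<rho>) = heading (\<alpha> + \<sigma>)"
      using eq'[of 1] big pi_gt3 less s1 by (simp add: a_def)
    then have "\<alpha> + \<rho> = \<alpha> + \<sigma>"
      using \<sigma> \<rho>(1) pi_gt3 by (intro heading_eq_imp_eq) auto
    then have \<rho>\<sigma>: "\<rho> = \<sigma>" by simp
    \<comment> \<open>At \<open>a + h\<close> the first curve has turned back by \<open>h\<close>
      and the second has gone on by \<open>h\<close>; the gap \<open>2 * h\<close> is less than a
      full turn.\<close>
    define h where "h = min 1 (\<bar>\<psi>\<^sub>2 - \<alpha>\<bar> - a)"
    have h: "0 < h" "h \<le> 1" "a + h \<le> \<bar>\<psi>\<^sub>2 - \<alpha>\<bar>" using less by (auto simp: h_def a_def)
    have sgn: "sgn (\<beta>\<^sub>1 - \<psi>\<^sub>1) = - \<sigma>"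
      using \<rho>(3) \<rho>\<sigma> by (metis minus_diff_eq sgn_minus)
    have \<psi>: "\<psi>\<^sub>1 = \<alpha> + \<sigma> * a"
      using \<rho>(2) unfolding \<rho>\<sigma> a_def by (metis sgn_mult_abs add_diff_cancel_left' diff_add_cancel add.commute)
    have angle: "csc_angle \<alpha> \<beta>\<^sub>1 \<psi>\<^sub>1 s\<^sub>1 (a + h) = \<psi>\<^sub>1 - \<sigma> * h"
      using csc_angle_last_arc[OF s1, of \<psi>\<^sub>1 \<alpha> "a + h" \<beta>\<^sub>1] h True sgn by (simp add: a_def)
    have "0 \<le> a + h" "a + h \<le> a + s\<^sub>1 + \<bar>\<beta>\<^sub>1 - \<psi>\<^sub>1\<bar>"
      using h a big pi_gt3 s1 by linarith+
    from eq'[OF this(1) h(3) this(2)] have "heading (\<psi>\<^sub>1 - \<sigma> * h) = heading (\<alpha> + \<sigma> * (a + h))"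
      unfolding angle .
    also have "\<alpha> + \<sigma> * (a + h) = \<psi>\<^sub>1 + \<sigma> * h"
      unfolding \<psi> by (simp add: algebra_simps)
    finally have "heading (\<psi>\<^sub>1 - \<sigma> * h) = heading (\<psi>\<^sub>1 + \<sigma> * h)" .
    then have "\<psi>\<^sub>1 - \<sigma> * h = \<psi>\<^sub>1 + \<sigma> * h"
      using \<sigma> h pi_gt3 by (intro heading_eq_imp_eq) auto
    then show False using \<sigma> h by auto
  qed
qed

text \<open>By symmetry the first arcs have equal length, and the tangent shortly after the start
  tells which way they turn.\<close>

lemma csc_curve_direction_unique:
  assumes v: "norm v \<ge> 4" and p: "csc_param v \<alpha> \<beta>\<^sub>1 \<psi>\<^sub>1" "csc_param v \<alpha> \<beta>\<^sub>2 \<psi>\<^sub>2"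
    and len: "csc_length v \<alpha> \<beta>\<^sub>1 \<psi>\<^sub>1 = csc_length v \<alpha> \<beta>\<^sub>2 \<psi>\<^sub>2"
    and eq: "\<And>t. t \<in> {0..csc_length v \<alpha> \<beta>\<^sub>1 \<psi>\<^sub>1} \<Longrightarrow>
      heading (csc_angle \<alpha> \<beta>\<^sub>1 \<psi>\<^sub>1 (csc_segment v \<alpha> \<beta>\<^sub>1 \<psi>\<^sub>1) t) =
      heading (csc_angle \<alpha> \<beta>\<^sub>2 \<psi>\<^sub>2 (csc_segment v \<alpha> \<beta>\<^sub>2 \<psi>\<^sub>2) t)"
  shows "\<psi>\<^sub>1 = \<psi>\<^sub>2"
proof -
  have s: "0 \<le> csc_segment v \<alpha> \<beta>\<^sub>1 \<psi>\<^sub>1" "0 \<le> csc_segment v \<alpha> \<beta>\<^sub>2 \<psi>\<^sub>2"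
    using p by (simp_all add: csc_param_def)
  have "\<bar>\<psi>\<^sub>2 - \<alpha>\<bar> \<le> \<bar>\<psi>\<^sub>1 - \<alpha>\<bar>"
    by (rule csc_curve_longer_arc[OF v p(1) eq s(2)])
  moreover have "\<bar>\<psi>\<^sub>1 - \<alpha>\<bar> \<le> \<bar>\<psi>\<^sub>2 - \<alpha>\<bar>"
    by (rule csc_curve_longer_arc[OF v p(2) _ s(1), of \<beta>\<^sub>1]) (use eq len in auto)
  ultimately have a: "\<bar>\<psi>\<^sub>1 - \<alpha>\<bar> = \<bar>\<psi>\<^sub>2 - \<alpha>\<bar>" by simp
  show ?thesis
  proof (cases "\<psi>\<^sub>1 = \<alpha>")
    case True then show ?thesis using a by simp
  next
    case False
    define t where "t = min 1 \<bar>\<psi>\<^sub>1 - \<alpha>\<bar>"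
    have t: "0 < t" "t \<le> 1" "t \<le> \<bar>\<psi>\<^sub>1 - \<alpha>\<bar>" "t \<le> \<bar>\<psi>\<^sub>2 - \<alpha>\<bar>"
      using False a by (auto simp: t_def)
    have "t \<le> csc_length v \<alpha> \<beta>\<^sub>1 \<psi>\<^sub>1"
      using t s(1) unfolding csc_length_alt by linarith
    then have "heading (\<alpha> + sgn (\<psi>\<^sub>1 - \<alpha>) * t) = heading (\<alpha> + sgn (\<psi>\<^sub>2 - \<alpha>) * t)"
      using eq[of t] t csc_angle_first_arc[OF s(1) t(3)] csc_angle_first_arc[OF s(2) t(4)] by simp
    then have "\<alpha> + sgn (\<psi>\<^sub>1 - \<alpha>) * t = \<alpha> + sgn (\<psi>\<^sub>2 - \<alpha>) * t"
      using t pi_gt3 by (intro heading_eq_imp_eq) (auto simp: sgn_if)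
    then have "sgn (\<psi>\<^sub>1 - \<alpha>) = sgn (\<psi>\<^sub>2 - \<alpha>)" using t by simp
    then have "\<psi>\<^sub>1 - \<alpha> = \<psi>\<^sub>2 - \<alpha>" using a by (metis sgn_mult_abs)
    then show ?thesis by simp
  qed
qed

section \<open>Legs of a tour\<close>

lemma has_vector_derivative_unique_Icc:
  fixes f :: "real \<Rightarrow> 'a::real_normed_vector"
  assumes "a < b" "t \<in> {a..b}"
    and "(f has_vector_derivative f') (at t within {a..b})" "(f has_vector_derivative f'') (at t within {a..b})"
  shows "f' = f''"
  using vector_derivative_unique_within_closed_interval[of a b t f f' f''] assms by simp

lemma unit_circle_arc_tangent:
  assumes arc: "unit_circle_arc \<gamma> a b" and "a \<le> b"
    and d: "\<And>t. t \<in> {a..b} \<Longrightarrow> (\<gamma> has_vector_derivative v t) (at t within {a..b})"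
    and va: "v a = heading \<eta>"
  obtains \<sigma> :: real where "\<sigma> \<in> {-1, 1}" "\<And>t. t \<in> {a..b} \<Longrightarrow> v t = heading (\<eta> + \<sigma> * (t - a))"
proof (cases "a = b")
  case True
  \<comment> \<open>An arc of length zero has no direction of travel; the choice of 1 is
    arbitrary.\<close>
  then show ?thesis using that[of 1] va by simp
next
  case False
  then have "a < b" using \<open>a \<le> b\<close> by simp
  obtain c \<phi> \<sigma> where \<sigma>: "\<sigma> \<in> {-1, 1}" and g: "\<And>s. s \<in> {a..b} \<Longrightarrow> \<gamma> s = c + heading (\<phi> + \<sigma> * (s - a))"
    using arc unfolding unit_circle_arc_def by blast
  have v: "v t = heading (\<phi> + \<sigma> * pi / 2 + \<sigma> * (t - a))" if t: "t \<in> {a..b}" for t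
  proof (rule has_vector_derivative_unique_Icc[OF \<open>a < b\<close> t d[OF t]])
    have "((\<lambda>s. heading (\<phi> + \<sigma> * (s - a))) has_vector_derivative
        \<sigma> *\<^sub>R heading (\<phi> + \<sigma> * (t - a) + pi / 2)) (at t within {a..b})"
      by (rule has_vector_derivative_heading) (auto intro!: derivative_eq_intros)
    from has_vector_derivative_add[OF has_vector_derivative_const[of c] this]
    have d': "((\<lambda>s. c + heading (\<phi> + \<sigma> * (s - a))) has_vector_derivative
        heading (\<phi> + \<sigma> * pi / 2 + \<sigma> * (t - a))) (at t within {a..b})"
      using heading_quarter_turn[OF \<sigma>, of "\<phi> + \<sigma> * (t - a)"] by (simp add: ac_simps)
    show "(\<gamma> has_vector_derivative heading (\<phi> + \<sigma> * pi / 2 + \<sigma> * (t - a))) (at t within {a..b})"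
      by (rule has_vector_derivative_transform[OF t _ d']) (rule g)
  qed
  have "heading (\<phi> + \<sigma> * pi / 2) = heading \<eta>"
    using v[of a] va \<open>a < b\<close> by simp
  from heading_add_cong[OF this] show ?thesis using that[OF \<sigma>] v by metis
qed

text \<open>Following the tangent from \<open>\<alpha>\<close> accumulates the angles without
  reduction modulo a full turn, so the arc lengths are differences of angles and \<open>m\<close>
  records the full turns in the final one. The moments are the components of the two arcs across the
  segment.\<close>

lemma csc_leg_params:
  assumes "curvature_bounded_curve p \<alpha> q \<beta> (leg_len c) (leg_pos c)" and csc: "csc_type c" and "p \<noteq> q"
  obtains \<psi> and m :: int where "csc_param (q - p) \<alpha> (\<beta> + 2 * pi * m) \<psi>"
    "leg_len c = csc_length (q - p) \<alpha> (\<beta> + 2 * pi * m) \<psi>"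
    "seg_dir c = heading \<psi>"
    "\<And>t. t \<in> {0..leg_len c} \<Longrightarrow> (leg_pos c has_vector_derivative
       heading (csc_angle \<alpha> (\<beta> + 2 * pi * m) \<psi> (csc_segment (q - p) \<alpha> (\<beta> + 2 * pi * m) \<psi>) t))
       (at t within {0..leg_len c})"
    "cross3 (horiz (leg_pos c (seg_begin c) - p)) (horiz (seg_dir c)) \<bullet> zhat = turn_lever (\<psi> - \<alpha>)"
    "cross3 (horiz (leg_pos c (seg_end c) - q)) (horiz (seg_dir c)) \<bullet> zhat
       = - turn_lever (\<psi> - (\<beta> + 2 * pi * m))"
proof -
  define \<gamma> l a e where "\<gamma> = leg_pos c" and "l = leg_len c" and "a = seg_begin c" and "e = seg_end c"
  obtain v where d: "\<And>s. s \<in> {0..l} \<Longrightarrow> (\<gamma> has_vector_derivative v s) (at s within {0..l})"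
    and ends: "0 \<le> l" "\<gamma> 0 = p" "v 0 = heading \<alpha>" "\<gamma> l = q" "v l = heading \<beta>"
    using assms(1) unfolding curvature_bounded_curve_def \<gamma>_def l_def by blast
  have "l \<noteq> 0" using ends \<open>p \<noteq> q\<close> by auto
  then have "0 < l" using ends by simp
  have ord: "0 \<le> a" "a \<le> e" "e \<le> l"
    and arc1: "unit_circle_arc \<gamma> 0 a" and arc2: "unit_circle_arc \<gamma> e l"
    and seg: "\<And>s. s \<in> {a..e} \<Longrightarrow> \<gamma> s = \<gamma> a + (s - a) *\<^sub>R seg_dir c"
    and dir: "(\<gamma> has_vector_derivative seg_dir c) (at a within {0..l})"
    using csc unfolding csc_type_def \<gamma>_def l_def a_def e_def by blast+
  have d': "(\<gamma> has_vector_derivative v t) (at t within {b..b'})" if "t \<in> {b..b'}" "0 \<le> b" "b' \<le> l" for b b' t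
    using d[of t] that by (auto intro: has_vector_derivative_within_subset)
  obtain \<sigma>\<^sub>1 :: real where \<sigma>1: "\<sigma>\<^sub>1 \<in> {-1, 1}" and v1: "\<And>t. t \<in> {0..a} \<Longrightarrow> v t = heading (\<alpha> + \<sigma>\<^sub>1 * (t - 0))"
    using unit_circle_arc_tangent[OF arc1 ord(1), of v \<alpha>] d'[of _ 0 a] ends(3) ord by auto
  define \<psi> where "\<psi> = \<alpha> + \<sigma>\<^sub>1 * a"
  have va: "v a = heading \<psi>" using v1[of a] ord by (simp add: \<psi>_def)
  \<comment> \<open>The tangent at the beginning of the segment decides, which also covers a segment
    of length zero.\<close>
  have u: "seg_dir c = heading \<psi>"
    using has_vector_derivative_unique_Icc[OF \<open>0 < l\<close> _ dir d] va ord by simp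
  have v2: "v t = heading \<psi>" if t: "t \<in> {a..e}" for t
  proof (cases "a = e")
    case True
    then show ?thesis using va t by simp
  next
    case False
    then have "a < e" using ord by simp
    then show ?thesis
    proof (rule has_vector_derivative_unique_Icc[OF _ t])
      show "(\<gamma> has_vector_derivative v t) (at t within {a..e})" using d'[OF t] ord by simp
      have d\<gamma>: "((\<lambda>s. \<gamma> a + (s - a) *\<^sub>R seg_dir c) has_vector_derivative heading \<psi>) (at t within {a..e})"
        unfolding u by (auto intro!: derivative_eq_intros)
      show "(\<gamma> has_vector_derivative heading \<psi>) (at t within {a..e})"
        by (rule has_vector_derivative_transform[OF t _ d\<gamma>]) (rule seg)
    qed
  qed
  obtain \<sigma>\<^sub>2 :: real where \<sigma>2: "\<sigma>\<^sub>2 \<in> {-1, 1}" and v3: "\<And>t. t \<in> {e..l} \<Longrightarrow> v t = heading (\<psi> + \<sigma>\<^sub>2 * (t - e))"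
    using unit_circle_arc_tangent[OF arc2 ord(3), of v \<psi>] d'[of _ e l] v2[of e] ord by auto
  define B where "B = \<psi> + \<sigma>\<^sub>2 * (l - e)"
  have "heading B = heading \<beta>" using v3[of l] ends(5) ord by (simp add: B_def)
  then obtain m :: int where m: "B = \<beta> + 2 * pi * m" using heading_eq_iff by blast
  define s where "s = e - a"
  have s: "0 \<le> s" using ord by (simp add: s_def)
  have a: "a = \<bar>\<psi> - \<alpha>\<bar>" using \<sigma>1 ord by (auto simp: \<psi>_def)
  have b: "l - e = \<bar>B - \<psi>\<bar>" using \<sigma>2 ord by (auto simp: B_def)
  have l: "l = \<bar>\<psi> - \<alpha>\<bar> + s + \<bar>B - \<psi>\<bar>" using a b by (simp add: s_def)
  have v: "v t = heading (csc_angle \<alpha> B \<psi> s t)" if t: "t \<in> {0..l}" for t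
  proof -
    consider "t \<in> {0..a}" | "t \<in> {a..e}" | "t \<in> {e..l}" using t by fastforce
    then show ?thesis
    proof cases
      case 1
      \<comment> \<open>On an empty arc the sign is 0 and differs from
        \<open>\<sigma>\<^sub>1\<close>, but then \<open>t = 0\<close>.\<close>
      have turn: "sgn (\<psi> - \<alpha>) * t = \<sigma>\<^sub>1 * t"
        using 1 \<sigma>1 ord by (cases "a = 0") (auto simp: \<psi>_def sgn_mult)
      have "csc_angle \<alpha> B \<psi> s t = \<alpha> + \<sigma>\<^sub>1 * t"
        using 1 csc_angle_first_arc[OF s, of t \<psi> \<alpha> B] a unfolding turn by simp
      then show ?thesis using v1[OF 1] by simp
    next
      case 2
      then show ?thesis using v2 csc_angle_segment[of \<psi> \<alpha> t s B] a by (simp add: s_def)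
    next
      case 3
      have turn: "sgn (B - \<psi>) * (t - e) = \<sigma>\<^sub>2 * (t - e)"
        using 3 \<sigma>2 ord by (cases "e = l") (auto simp: B_def sgn_mult)
      have e: "\<bar>\<psi> - \<alpha>\<bar> + s = e" using a by (simp add: s_def)
      have "csc_angle \<alpha> B \<psi> s t = \<psi> + \<sigma>\<^sub>2 * (t - e)"
        using 3 csc_angle_last_arc[OF s, of \<psi> \<alpha> t B] unfolding e turn by simp
      then show ?thesis using v3[OF 3] by simp
    qed
  qed
  have d: "(\<gamma> has_vector_derivative heading (csc_angle \<alpha> B \<psi> s t)) (at t within {0..l})"
    if "t \<in> {0..l}" for t using d v that by metis
  have E: "(q - p) $ 1 * cos \<psi> + (q - p) $ 2 * sin \<psi> = sin \<bar>\<psi> - \<alpha>\<bar> + s + sin \<bar>B - \<psi>\<bar>"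
    "(q - p) $ 1 * sin \<psi> - (q - p) $ 2 * cos \<psi> = turn_lever (\<psi> - \<alpha>) - turn_lever (B - \<psi>)"
    using csc_endpoint[OF s l d] unfolding ends by simp_all
  have minus: "turn_lever (B - \<psi>) = - turn_lever (\<psi> - B)"
    using turn_lever_minus[of "\<psi> - B"] by simp
  have seg_s: "csc_segment (q - p) \<alpha> B \<psi> = s"
    unfolding csc_segment_def E by (simp add: abs_minus_commute)
  have "csc_slope (q - p) \<alpha> B \<psi> = 0"
    unfolding csc_slope_def E minus by simp
  then have 1: "csc_param (q - p) \<alpha> B \<psi>" using s by (simp add: csc_param_def seg_s)
  have 2: "l = csc_length (q - p) \<alpha> B \<psi>" by (simp add: csc_length_alt seg_s l)
  have D: "\<gamma> a - p = sgn (\<psi> - \<alpha>) *\<^sub>R (heading (\<psi> - pi / 2) - heading (\<alpha> - pi / 2))"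
    "q - \<gamma> e = sgn (B - \<psi>) *\<^sub>R (heading (B - pi / 2) - heading (\<psi> - pi / 2))"
    using csc_displacements(1,3)[OF s l d, folded a] unfolding ends s_def by simp_all
  have 3: "cross3 (horiz (\<gamma> a - p)) (horiz (seg_dir c)) \<bullet> zhat = turn_lever (\<psi> - \<alpha>)"
    unfolding cross3_horiz_zhat u heading_nth D turn_components ..
  have "cross3 (horiz (\<gamma> e - q)) (horiz (seg_dir c)) \<bullet> zhat
      = - ((q - \<gamma> e) $ 1 * sin \<psi> - (q - \<gamma> e) $ 2 * cos \<psi>)"
    unfolding cross3_horiz_zhat u heading_nth by (simp add: algebra_simps)
  also have "\<dots> = - turn_lever (\<psi> - B)"
    unfolding D turn_components minus by simp
  finally show ?thesis
    using that[of m \<psi>] 1 2 3 u d unfolding m[symmetric] seg_s \<gamma>_def l_def a_def e_def by blast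
qed

section \<open>Critical points as competitors, and consequences of uniqueness\<close>

lemma curvature_bounded_curve_cong:
  "heading \<beta> = heading \<beta>' \<Longrightarrow>
    curvature_bounded_curve p \<alpha> q \<beta> l \<gamma> \<longleftrightarrow> curvature_bounded_curve p \<alpha> q \<beta>' l \<gamma>"
  by (simp add: curvature_bounded_curve_def)

lemma csc_param_curve:
  fixes m :: int
  assumes p: "csc_param (q - p) \<alpha> (\<beta> + 2 * pi * m) \<psi>"
  obtains \<gamma> where "curvature_bounded_curve p \<alpha> q \<beta> (csc_length (q - p) \<alpha> (\<beta> + 2 * pi * m) \<psi>) \<gamma>"
    "\<And>t. t \<in> {0..csc_length (q - p) \<alpha> (\<beta> + 2 * pi * m) \<psi>} \<Longrightarrow>
      (\<gamma> has_vector_derivative heading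
        (csc_angle \<alpha> (\<beta> + 2 * pi * m) \<psi> (csc_segment (q - p) \<alpha> (\<beta> + 2 * pi * m) \<psi>) t))
        (at t within {0..csc_length (q - p) \<alpha> (\<beta> + 2 * pi * m) \<psi>})"
proof -
  have "heading (\<beta> + 2 * pi * m) = heading \<beta>" using heading_eq_iff by blast
  note cong = curvature_bounded_curve_cong[OF this]
  show ?thesis
    by (rule csc_curve_exists[OF p, of p]) (rule that, simp_all add: cong)
qed

lemma dubins_curve_le_csc_length:
  fixes m :: int
  assumes "dubins_curve p \<alpha> q \<beta> l \<gamma>" and "csc_param (q - p) \<alpha> (\<beta> + 2 * pi * m) \<psi>"
  shows "l \<le> csc_length (q - p) \<alpha> (\<beta> + 2 * pi * m) \<psi>"
  using csc_param_curve[OF assms(2)] assms(1) unfolding dubins_curve_def by metis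

text \<open>A critical point of the same length is realised by another Dubins curve, which must be
  \<open>\<gamma>\<close>; equal curves have equal tangents, and these determine the
  direction.\<close>

lemma unique_dubins_curve_direction:
  fixes m m' :: int
  assumes v: "norm (q - p) \<ge> 4"
    and dubins: "dubins_curve p \<alpha> q \<beta> l \<gamma>"
    and unique: "\<And>l' \<gamma>'. dubins_curve p \<alpha> q \<beta> l' \<gamma>' \<Longrightarrow> \<forall>s\<in>{0..l'}. \<gamma>' s = \<gamma> s"
    and p1: "csc_param (q - p) \<alpha> (\<beta> + 2 * pi * m) \<psi>" and l1: "l = csc_length (q - p) \<alpha> (\<beta> + 2 * pi * m) \<psi>"
    and d: "\<And>t. t \<in> {0..l} \<Longrightarrow> (\<gamma> has_vector_derivative
       heading (csc_angle \<alpha> (\<beta> + 2 * pi * m) \<psi> (csc_segment (q - p) \<alpha> (\<beta> + 2 * pi * m) \<psi>) t))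
       (at t within {0..l})"
    and p2: "csc_param (q - p) \<alpha> (\<beta> + 2 * pi * m') \<psi>'" and l2: "l = csc_length (q - p) \<alpha> (\<beta> + 2 * pi * m') \<psi>'"
  shows "\<psi> = \<psi>'"
proof -
  obtain \<gamma>' where g: "curvature_bounded_curve p \<alpha> q \<beta> l \<gamma>'"
    and d': "\<And>t. t \<in> {0..l} \<Longrightarrow> (\<gamma>' has_vector_derivative heading
        (csc_angle \<alpha> (\<beta> + 2 * pi * m') \<psi>' (csc_segment (q - p) \<alpha> (\<beta> + 2 * pi * m') \<psi>') t))
        (at t within {0..l})"
    using csc_param_curve[OF p2] unfolding l2 by blast
  have "dubins_curve p \<alpha> q \<beta> l \<gamma>'" using g dubins by (simp add: dubins_curve_def)
  then have eq: "\<And>s. s \<in> {0..l} \<Longrightarrow> \<gamma>' s = \<gamma> s" using unique by blast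
  have ends: "0 \<le> l" "\<gamma>' 0 = p" "\<gamma>' l = q"
    using g unfolding curvature_bounded_curve_def by auto
  moreover have "p \<noteq> q" using v by auto
  ultimately have "0 < l" by (metis order_le_less)
  show ?thesis
  proof (rule csc_curve_direction_unique[OF v p1 p2])
    fix t assume "t \<in> {0..csc_length (q - p) \<alpha> (\<beta> + 2 * pi * m) \<psi>}"
    then have t: "t \<in> {0..l}" by (simp add: l1)
    show "heading (csc_angle \<alpha> (\<beta> + 2 * pi * m) \<psi> (csc_segment (q - p) \<alpha> (\<beta> + 2 * pi * m) \<psi>) t) =
       heading (csc_angle \<alpha> (\<beta> + 2 * pi * m') \<psi>' (csc_segment (q - p) \<alpha> (\<beta> + 2 * pi * m') \<psi>') t)"
      by (rule has_vector_derivative_unique_Icc[OF \<open>0 < l\<close> t _ d'[OF t]],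
          rule has_vector_derivative_transform[OF t eq d[OF t]])
  qed (use l1 l2 in simp)
qed

text \<open>Exchanging the two headings reduces a variation of the final heading to one of the initial
  heading.\<close>

lemma csc_swap:
  fixes m :: int
  shows "csc_param v t (\<alpha> + 2 * pi * m) \<psi> \<longleftrightarrow> csc_param v \<alpha> (t + 2 * pi * of_int (- m)) (\<psi> + 2 * pi * of_int (- m))"
    and "csc_length v t (\<alpha> + 2 * pi * m) \<psi> = csc_length v \<alpha> (t + 2 * pi * of_int (- m)) (\<psi> + 2 * pi * of_int (- m))"
proof -
  have "heading (\<psi> + 2 * pi * of_int (- m)) = heading \<psi>" using heading_eq_iff by blast
  then have "cos (\<psi> + 2 * pi * of_int (- m)) = cos \<psi>" "sin (\<psi> + 2 * pi * of_int (- m)) = sin \<psi>"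
    by (simp_all only: vec2_eq_iff heading_nth)
  moreover have "\<psi> + 2 * pi * of_int (- m) - \<alpha> = \<psi> - (\<alpha> + 2 * pi * m)"
    "\<psi> + 2 * pi * of_int (- m) - (t + 2 * pi * of_int (- m)) = \<psi> - t" by simp_all
  ultimately show "csc_param v t (\<alpha> + 2 * pi * m) \<psi> \<longleftrightarrow> csc_param v \<alpha> (t + 2 * pi * of_int (- m)) (\<psi> + 2 * pi * of_int (- m))"
    "csc_length v t (\<alpha> + 2 * pi * m) \<psi> = csc_length v \<alpha> (t + 2 * pi * of_int (- m)) (\<psi> + 2 * pi * of_int (- m))"
    unfolding csc_param_def csc_slope_def csc_segment_def csc_length_def by (auto simp only: ac_simps)
qed

section \<open>Varying one heading of one leg\<close>

text \<open>The Dubins length is a minimum over critical points: the parameters read off the leg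
  attain it, and the curves of all others bound it. Hence the two abstract results apply, with the
  lever of the leg at \<open>t\<^sub>0\<close>.\<close>

lemma dubins_length_start_variation:
  fixes c :: "real \<Rightarrow> leg" and t\<^sub>0 :: real
  assumes v: "norm (q - p) \<ge> 4"
    and leg: "\<And>t. dubins_curve p t q \<beta> (leg_len (c t)) (leg_pos (c t))" "\<And>t. csc_type (c t)"
  defines "K \<equiv> - (cross3 (horiz (leg_pos (c t\<^sub>0) (seg_begin (c t\<^sub>0)) - p)) (horiz (seg_dir (c t\<^sub>0))) \<bullet> zhat)"
  shows "upper_linear (\<lambda>t. leg_len (c t)) K t\<^sub>0"
    and "(\<And>l \<gamma>. dubins_curve p t\<^sub>0 q \<beta> l \<gamma> \<Longrightarrow> \<forall>s\<in>{0..l}. \<gamma> s = leg_pos (c t\<^sub>0) s) \<Longrightarrow>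
      ((\<lambda>t. leg_len (c t)) has_real_derivative K) (at t\<^sub>0)"
proof -
  let ?v = "q - p"
  have "p \<noteq> q" using v by auto
  have bounded: "curvature_bounded_curve p t q \<beta> (leg_len (c t)) (leg_pos (c t))" for t
    using leg(1) unfolding dubins_curve_def by blast
  note params = csc_leg_params[OF bounded leg(2) \<open>p \<noteq> q\<close>]
  note le = dubins_curve_le_csc_length[OF leg(1)]
  obtain \<psi> and m :: int where 0: "csc_param ?v t\<^sub>0 (\<beta> + 2 * pi * m) \<psi>"
    "leg_len (c t\<^sub>0) = csc_length ?v t\<^sub>0 (\<beta> + 2 * pi * m) \<psi>"
    "\<And>t. t \<in> {0..leg_len (c t\<^sub>0)} \<Longrightarrow> (leg_pos (c t\<^sub>0) has_vector_derivative
       heading (csc_angle t\<^sub>0 (\<beta> + 2 * pi * m) \<psi> (csc_segment (q - p) t\<^sub>0 (\<beta> + 2 * pi * m) \<psi>) t))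
       (at t within {0..leg_len (c t\<^sub>0)})"
    and K: "K = - turn_lever (\<psi> - t\<^sub>0)"
    by (rule params[of t\<^sub>0]) (rule that, assumption+, simp add: K_def)
  show "upper_linear (\<lambda>t. leg_len (c t)) K t\<^sub>0"
    unfolding K by (rule csc_min_upper_linear[OF v le 0(1,2)])
  assume unique: "\<And>l \<gamma>. dubins_curve p t\<^sub>0 q \<beta> l \<gamma> \<Longrightarrow> \<forall>s\<in>{0..l}. \<gamma> s = leg_pos (c t\<^sub>0) s"
  show "((\<lambda>t. leg_len (c t)) has_real_derivative K) (at t\<^sub>0)"
    unfolding K
  proof (rule csc_min_has_derivative[OF v le])
    show "\<exists>\<psi> m::int. csc_param ?v t (\<beta> + 2 * pi * m) \<psi> \<and> leg_len (c t) = csc_length ?v t (\<beta> + 2 * pi * m) \<psi>" for t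
      by (rule params[of t]) blast
    show "turn_lever (\<psi>' - t\<^sub>0) = turn_lever (\<psi> - t\<^sub>0)"
      if "csc_param ?v t\<^sub>0 (\<beta> + 2 * pi * m') \<psi>'" "leg_len (c t\<^sub>0) = csc_length ?v t\<^sub>0 (\<beta> + 2 * pi * m') \<psi>'"
      for \<psi>' and m' :: int
      using unique_dubins_curve_direction[OF v leg(1) unique 0 that] by simp
  qed
qed

lemma dubins_length_end_variation:
  fixes c :: "real \<Rightarrow> leg" and t\<^sub>0 :: real
  assumes v: "norm (q - p) \<ge> 4"
    and leg: "\<And>t. dubins_curve p \<alpha> q t (leg_len (c t)) (leg_pos (c t))" "\<And>t. csc_type (c t)"
  defines "K \<equiv> cross3 (horiz (leg_pos (c t\<^sub>0) (seg_end (c t\<^sub>0)) - q)) (horiz (seg_dir (c t\<^sub>0))) \<bullet> zhat"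
  shows "upper_linear (\<lambda>t. leg_len (c t)) K t\<^sub>0"
    and "(\<And>l \<gamma>. dubins_curve p \<alpha> q t\<^sub>0 l \<gamma> \<Longrightarrow> \<forall>s\<in>{0..l}. \<gamma> s = leg_pos (c t\<^sub>0) s) \<Longrightarrow>
      ((\<lambda>t. leg_len (c t)) has_real_derivative K) (at t\<^sub>0)"
proof -
  let ?v = "q - p"
  have "p \<noteq> q" using v by auto
  have bounded: "curvature_bounded_curve p \<alpha> q t (leg_len (c t)) (leg_pos (c t))" for t
    using leg(1) unfolding dubins_curve_def by blast
  note params = csc_leg_params[OF bounded leg(2) \<open>p \<noteq> q\<close>]
  have le: "leg_len (c t) \<le> csc_length ?v t (\<alpha> + 2 * pi * m) \<psi>"
    if "csc_param ?v t (\<alpha> + 2 * pi * m) \<psi>" for t \<psi> and m :: int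
    using dubins_curve_le_csc_length[OF leg(1) iffD1[OF csc_swap(1) that]] csc_swap(2) by metis
  have attained: "csc_param ?v t (\<alpha> + 2 * pi * of_int (- m)) (\<psi> - 2 * pi * m)
      \<and> leg_len (c t) = csc_length ?v t (\<alpha> + 2 * pi * of_int (- m)) (\<psi> - 2 * pi * m)"
    if "csc_param ?v \<alpha> (t + 2 * pi * m) \<psi>" "leg_len (c t) = csc_length ?v \<alpha> (t + 2 * pi * m) \<psi>"
    for t \<psi> and m :: int
    using that csc_swap[of ?v t \<alpha> "- m" "\<psi> - 2 * pi * m"] by simp
  obtain \<psi> and m :: int where 0: "csc_param ?v \<alpha> (t\<^sub>0 + 2 * pi * m) \<psi>"
    "leg_len (c t\<^sub>0) = csc_length ?v \<alpha> (t\<^sub>0 + 2 * pi * m) \<psi>"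
    "\<And>t. t \<in> {0..leg_len (c t\<^sub>0)} \<Longrightarrow> (leg_pos (c t\<^sub>0) has_vector_derivative
       heading (csc_angle \<alpha> (t\<^sub>0 + 2 * pi * m) \<psi> (csc_segment (q - p) \<alpha> (t\<^sub>0 + 2 * pi * m) \<psi>) t))
       (at t within {0..leg_len (c t\<^sub>0)})"
    and K: "K = - turn_lever (\<psi> - (t\<^sub>0 + 2 * pi * m))"
    by (rule params[of t\<^sub>0]) (rule that, assumption+, simp add: K_def)
  \<comment> \<open>Moving the full turns from the heading to the direction gives the parameters in
    the exchanged problem.\<close>
  have K': "K = - turn_lever (\<psi> - 2 * pi * m - t\<^sub>0)" unfolding K by (simp add: algebra_simps)
  show "upper_linear (\<lambda>t. leg_len (c t)) K t\<^sub>0"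
    unfolding K'
    by (rule csc_min_upper_linear[OF v le conjunct1[OF attained] conjunct2[OF attained]]) (assumption | rule 0)+
  assume unique: "\<And>l \<gamma>. dubins_curve p \<alpha> q t\<^sub>0 l \<gamma> \<Longrightarrow> \<forall>s\<in>{0..l}. \<gamma> s = leg_pos (c t\<^sub>0) s"
  show "((\<lambda>t. leg_len (c t)) has_real_derivative K) (at t\<^sub>0)"
    unfolding K
  proof (rule csc_min_has_derivative[OF v le])
    show "\<exists>\<psi> m::int. csc_param ?v t (\<alpha> + 2 * pi * m) \<psi> \<and> leg_len (c t) = csc_length ?v t (\<alpha> + 2 * pi * m) \<psi>" for t
      by (rule params[of t]) (blast dest: attained)
    show "turn_lever (\<psi>' - t\<^sub>0) = turn_lever (\<psi> - (t\<^sub>0 + 2 * pi * m))"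
      if that: "csc_param ?v t\<^sub>0 (\<alpha> + 2 * pi * m') \<psi>'" "leg_len (c t\<^sub>0) = csc_length ?v t\<^sub>0 (\<alpha> + 2 * pi * m') \<psi>'"
      for \<psi>' and m' :: int
    proof -
      note that' = iffD1[OF csc_swap(1) that(1)] that(2)[unfolded csc_swap(2)[of ?v t\<^sub>0 \<alpha> m' \<psi>']]
      have "\<psi> = \<psi>' + 2 * pi * of_int (- m')"
        by (rule unique_dubins_curve_direction[OF v leg(1) unique 0 that'])
      \<comment> \<open>Uniqueness has identified the directions but not the numbers of full turns.
        With the direction and \<open>\<alpha>\<close> equal, the two slope equations force equal
        levers at the final end.\<close>
      moreover have "csc_slope ?v \<alpha> (t\<^sub>0 + 2 * pi * m) \<psi> = 0"
        "csc_slope ?v \<alpha> (t\<^sub>0 + 2 * pi * of_int (- m')) (\<psi>' + 2 * pi * of_int (- m')) = 0"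
        using 0(1) that'(1) by (simp_all only: csc_param_def)
      ultimately show ?thesis by (simp add: csc_slope_def)
    qed
  qed
qed

section \<open>The whole tour and its torque\<close>

lemma dubins_curve_length_unique:
  "dubins_curve p \<alpha> q \<beta> l \<gamma> \<Longrightarrow> dubins_curve p \<alpha> q \<beta> l' \<gamma>' \<Longrightarrow> l = l'"
  unfolding dubins_curve_def by (meson order_antisym)

text \<open>The backward pull along the arriving segment supplies the minus sign, and cross products
  of horizontal vectors are vertical.\<close>

lemma band_torque_eq_tau: "band_torque n x T i = tau n x T i *\<^sub>R zhat"
  by (simp add: band_torque_def torque_def tau_def Let_def vec_eq_iff forall_3 cross3_def
      horiz_def zhat_def axis_def inner_vec_def sum_3 algebra_simps)

theorem theorem2p5:
  fixes n i :: nat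
    and x :: "nat \<Rightarrow> real^2"
    and tour :: "(nat \<Rightarrow> real) \<Rightarrow> nat \<Rightarrow> leg"
    and \<theta> :: "nat \<Rightarrow> real"
    and L :: "(nat \<Rightarrow> real) \<Rightarrow> real"
  assumes "2 \<le> n"
    and "inj_on x {1..n}"
    and "\<forall>j\<in>{1..n}. \<forall>k\<in>{1..n}. j \<noteq> k \<longrightarrow> 4 \<le> dist (x j) (x k)"
    and "\<forall>\<phi>. dubins_tour n x \<phi> (tour \<phi>)"
    and "\<forall>\<phi>. L \<phi> = tour_length n (tour \<phi>)"
    and "i \<in> {1..n}"
  shows
    "(unique_dubins_leg n x \<theta> (tour \<theta>) (cprev n i) \<and> unique_dubins_leg n x \<theta> (tour \<theta>) i \<longrightarrow>
        ((\<lambda>t. L (\<theta>(i := t))) has_real_derivative - tau n x (tour \<theta>) i) (at (\<theta> i))) \<and>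
     (\<forall>D. ((\<lambda>t. L (\<theta>(i := t))) has_real_derivative D) (at (\<theta> i)) \<longrightarrow>
        D = - tau n x (tour \<theta>) i) \<and>
     band_torque n x (tour \<theta>) i = tau n x (tour \<theta>) i *\<^sub>R zhat"
proof -
  define j k where "j = cnext n i" and "k = cprev n i"
  have ijk: "i \<in> {1..n}" "j \<in> {1..n}" "k \<in> {1..n}" "i \<noteq> j" "i \<noteq> k" "cnext n k = i"
    using assms(1,6) by (auto simp: j_def k_def cnext_def cprev_def)
  \<comment> \<open>Only the legs \<open>k\<close> and \<open>i\<close> have an end at the
    \<open>i\<close>th point.\<close>
  have other: "cnext n h \<noteq> i" if "h \<in> {1..n}" "h \<noteq> k" for h
    using that assms(1,6) by (auto simp: k_def cnext_def cprev_def split: if_splits)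
  have norms: "norm (x j - x i) \<ge> 4" "norm (x i - x k) \<ge> 4"
    using assms(3) ijk by (auto simp: dist_norm[symmetric])
  have leg: "dubins_curve (x h) (\<phi> h) (x (cnext n h)) (\<phi> (cnext n h)) (leg_len (tour \<phi> h)) (leg_pos (tour \<phi> h))"
    "csc_type (tour \<phi> h)" if "h \<in> {1..n}" for \<phi> h
    using assms(4) that unfolding dubins_tour_def by auto
  define c where "c h t = tour (\<theta>(i := t)) h" for h t
  have c0: "c h (\<theta> i) = tour \<theta> h" for h by (simp add: c_def)
  have leg_i: "dubins_curve (x i) t (x j) (\<theta> j) (leg_len (c i t)) (leg_pos (c i t))" "csc_type (c i t)" for t
    using leg[of i "\<theta>(i := t)"] ijk by (auto simp: c_def j_def)
  have leg_k: "dubins_curve (x k) (\<theta> k) (x i) t (leg_len (c k t)) (leg_pos (c k t))" "csc_type (c k t)" for t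
    using leg[of k "\<theta>(i := t)"] ijk by (auto simp: c_def)
  \<comment> \<open>\<open>tour\<close> may select a different Dubins curve here when the
    \<open>i\<close>th heading changes, but the end data fix its length.\<close>
  have const: "leg_len (c h t) = leg_len (tour \<theta> h)" if "h \<in> {1..n} - {i, k}" for h t
    using leg(1)[of h "\<theta>(i := t)"] leg(1)[of h \<theta>] that other[of h]
    by (auto simp: c_def intro: dubins_curve_length_unique)
  define C where "C = (\<Sum>h\<in>{1..n} - {i, k}. leg_len (tour \<theta> h))"
  have L: "L (\<theta>(i := t)) = (leg_len (c k t) + leg_len (c i t)) + C" for t
  proof -
    have "L (\<theta>(i := t)) = (\<Sum>h\<in>{1..n}. leg_len (c h t))"
      using assms(5) by (simp add: tour_length_def c_def)
    also have "\<dots> = (\<Sum>h\<in>{1..n} - {i, k}. leg_len (c h t)) + (\<Sum>h\<in>{i, k}. leg_len (c h t))"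
      using ijk by (intro sum.subset_diff) auto
    also have "(\<Sum>h\<in>{1..n} - {i, k}. leg_len (c h t)) = C"
      unfolding C_def using const by (rule sum.cong[OF refl])
    finally show ?thesis using ijk by (simp add: fun_upd_def)
  qed
  note V_i = dubins_length_start_variation[OF norms(1) leg_i, of "\<theta> i", unfolded c0]
  note V_k = dubins_length_end_variation[OF norms(2) leg_k, of "\<theta> i", unfolded c0]
  have tau: "- tau n x (tour \<theta>) i =
    cross3 (horiz (leg_pos (tour \<theta> k) (seg_end (tour \<theta> k)) - x i)) (horiz (seg_dir (tour \<theta> k))) \<bullet> zhat
    + - (cross3 (horiz (leg_pos (tour \<theta> i) (seg_begin (tour \<theta> i)) - x i)) (horiz (seg_dir (tour \<theta> i))) \<bullet> zhat)"
    by (simp add: tau_def Let_def tpt1_def tpt2_def k_def inner_diff_left)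
  \<comment> \<open>The bounds from above for the two legs add up to one for \<open>L\<close>, which
    fixes the value of any derivative.\<close>
  have "upper_linear (\<lambda>t. leg_len (c k t) + leg_len (c i t)) (- tau n x (tour \<theta>) i) (\<theta> i)"
    unfolding tau by (rule upper_linear_add[OF V_k(1) V_i(1)])
  from upper_linear_add[OF this upper_linear_const[of C]]
  have upper: "upper_linear (\<lambda>t. L (\<theta>(i := t))) (- tau n x (tour \<theta>) i) (\<theta> i)"
    unfolding L by simp
  have "((\<lambda>t. L (\<theta>(i := t))) has_real_derivative - tau n x (tour \<theta>) i) (at (\<theta> i))"
    if "unique_dubins_leg n x \<theta> (tour \<theta>) k" "unique_dubins_leg n x \<theta> (tour \<theta>) i"
  proof -
    have "((\<lambda>t. leg_len (c k t) + leg_len (c i t)) has_real_derivative - tau n x (tour \<theta>) i) (at (\<theta> i))"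
      unfolding tau
      by (rule DERIV_add[OF V_k(2) V_i(2)])
        (use that in \<open>auto simp: unique_dubins_leg_def ijk(6) j_def\<close>)
    from DERIV_add[OF this DERIV_const[of C]] show ?thesis unfolding L by simp
  qed
  then show ?thesis
    using upper_linear_derivative_unique[OF upper] band_torque_eq_tau unfolding k_def by blast
qed

end
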